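(* Let $S$ be an inverse semigroup and let $\nu$ be a congruence on $S$. Then the universal groupoid $G_u(S/\nu)$ is isomorphic (as an étale topological groupoid) to the quotient groupoid $G_u(S)_{F_\nu}/G_u(\ker\nu)_{F_\nu}$.
   Context: An inverse semigroup is a semigroup $S$ in which every $s$ has a unique $s^*$ with $s=ss^*s$, $s^*=s^*ss^*$. $E(S)$ is the (commutative) semigroup of idempotents, ordered by $e\le f$ iff $ef=e$. A subsemigroup is a subset closed under product and $s\mapsto s^*$. A congruence $\nu$ on $S$ is an equivalence relation such that $(s,t)\in\nu$ implies $(as,at),(sa,ta)\in\nu$ for all $a\in S$; then $S/\nu$ is an inverse semigroup; let $q\colon S\to S/\nu$ be the quotient map. Put $\ker\nu=q^{-1}(E(S/\nu))$, a subsemigroup of $S$ containing $E(S)$. Characters: $\widehat{E(S)}$ is the set of nonzero semigroup homomorphisms $E(S)\to\{0,1\}$ (usual product on $\{0,1\}$) with the topology of pointwise convergence. Spectral action: for $e\in E(S)$ let $D_e=\{\xi\in\widehat{E(S)}:\xi(e)=1\}$; for $s\in S$ and $\xi\in D_{s^*s}$ let $\beta_s(\xi)\in D_{ss^*}$ be $\beta_s(\xi)(e)=\xi(s^*es)$. Universal groupoid $G_u(S)$: the set of classes $[s,\xi]$ of pairs $(s,\xi)\in S\times\widehat{E(S)}$ with $\xi(s^*s)=1$, where $(s,\xi)\sim(t,\eta)$ iff $\xi=\eta$ and there is $e\in E(S)$ with $\xi(e)=1$ and $se=te$. The unit space is $\widehat{E(S)}$ (via $\xi\mapsto[e,\xi]$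 for any $e$ with $\xi(e)=1$), $d([s,\xi])=\xi$, $r([s,\xi])=\beta_s(\xi)$, $[s,\beta_t(\xi)][t,\xi]=[st,\xi]$, $[s,\xi]^{-1}=[s^*,\beta_s(\xi)]$. The sets $\{[s,\xi]:\xi\in U\}$, with $s\in S$ and $U\subset D_{s^*s}$ open, form a basis of the topology; $G_u(S)$ is an étale groupoid (topological groupoid whose source map is a local homeomorphism). If $H\subset S$ is a subsemigroup with $E(S)\subset H$, then $[s,\xi]\mapsto[s,\xi]$ identifies $G_u(H)$ with an open subgroupoid of $G_u(S)$. For a groupoid $G$ and an invariant set $F\subset G^{(0)}$ (i.e. $d(\alpha)\in F\Rightarrow r(\alpha)\in F$), $G_F=d^{-1}(F)$ with the relative topology. Let $$F_\nu=\{\xi\circ q|_{E(S)}\in\widehat{E(S)}:\xi\in\widehat{E(S/\nu)}\},$$ a closed invariant subset of $\widehat{E(S)}$. A subgroupoid $H$ of $G$ is normal if $G^{(0)}\subset H\subset\{\gamma:d(\gamma)=r(\gamma)\}$ and $\alpha H\alpha^{-1}\subset H$ for all $\alpha\in G$. For an open normal subgroupoid $H$ of an étale groupoid $G$, $G/H$ is the quotient of $G$ by $\alpha\sim\beta$ iff $d(\alpha)=d(\beta)$ and $\alpha\beta^{-1}\in H$, with the induced groupoid structure and quotient topology; it is étale. $G_u(\ker\nu)_{F_\nu}$ is an open normal subgroupoid of $G_u(S)_{F_\nu}$. *)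

theory Defs
  imports "HOL-Analysis.Analysis"
begin

section \<open>Inverse semigroups and congruences\<close>

record 'a sgrp =
  carrier :: "'a set"
  mult :: "'a \<Rightarrow> 'a \<Rightarrow> 'a"  (infixl "\<cdot>\<index>" 70)

locale inverse_semigroup =
  fixes S :: "'a sgrp" (structure)
  assumes mult_closed: "\<lbrakk>s \<in> carrier S; t \<in> carrier S\<rbrakk> \<Longrightarrow> s \<cdot> t \<in> carrier S"
    and mult_assoc: "\<lbrakk>s \<in> carrier S; t \<in> carrier S; u \<in> carrier S\<rbrakk>
      \<Longrightarrow> (s \<cdot> t) \<cdot> u = s \<cdot> (t \<cdot> u)"
    and unique_inverse: "s \<in> carrier S
      \<Longrightarrow> \<exists>!t. t \<in> carrier S \<and> s = s \<cdot> t \<cdot> s \<and> t = t \<cdot> s \<cdot> t"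

definition star :: "'a sgrp \<Rightarrow> 'a \<Rightarrow> 'a" where
  "star S s = (THE t. t \<in> carrier S \<and> s = s \<cdot>\<^bsub>S\<^esub> t \<cdot>\<^bsub>S\<^esub> s \<and> t = t \<cdot>\<^bsub>S\<^esub> s \<cdot>\<^bsub>S\<^esub> t)"

definition idempotents :: "'a sgrp \<Rightarrow> 'a set" where
  "idempotents S = {e \<in> carrier S. e \<cdot>\<^bsub>S\<^esub> e = e}"

definition sgrp_congruence :: "'a sgrp \<Rightarrow> ('a \<times> 'a) set \<Rightarrow> bool" where
  "sgrp_congruence S \<nu> \<longleftrightarrow> equiv (carrier S) \<nu> \<and>
     (\<forall>(s, t) \<in> \<nu>. \<forall>a \<in> carrier S.
        (a \<cdot>\<^bsub>S\<^esub> s, a \<cdot>\<^bsub>S\<^esub> t) \<in> \<nu> \<and> (s \<cdot>\<^bsub>S\<^esub> a, t \<cdot>\<^bsub>S\<^esub> a) \<in> \<nu>)"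

text \<open>Operations on equivalence classes are written as the union of the classes obtained from all
  choices of representatives; when the operation is well defined, all these classes coincide.\<close>

definition quotient_sgrp :: "'a sgrp \<Rightarrow> ('a \<times> 'a) set \<Rightarrow> 'a set sgrp" where
  "quotient_sgrp S \<nu> =
     \<lparr> carrier = carrier S // \<nu>,
       mult = (\<lambda>C D. \<Union>s\<in>C. \<Union>t\<in>D. \<nu> `` {s \<cdot>\<^bsub>S\<^esub> t}) \<rparr>"

definition kernel_sgrp :: "'a sgrp \<Rightarrow> ('a \<times> 'a) set \<Rightarrow> 'a sgrp" where
  "kernel_sgrp S \<nu> =
     S\<lparr>carrier := {s \<in> carrier S. \<nu> `` {s} \<in> idempotents (quotient_sgrp S \<nu>)}\<rparr>"


section \<open>Characters and the spectral action\<close>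

text \<open>A character is a function on the idempotents with values in \<open>{0, 1}\<close>, represented by a function
  that is \<open>undefined\<close> off the idempotents, so that equal characters are equal functions.\<close>

definition characters :: "'a sgrp \<Rightarrow> ('a \<Rightarrow> nat) set" where
  "characters S = {\<xi> \<in> idempotents S \<rightarrow>\<^sub>E {0, 1}.
     (\<forall>e \<in> idempotents S. \<forall>f \<in> idempotents S. \<xi> (e \<cdot>\<^bsub>S\<^esub> f) = \<xi> e * \<xi> f) \<and>
     (\<exists>e \<in> idempotents S. \<xi> e \<noteq> 0)}"

definition character_topology :: "'a sgrp \<Rightarrow> ('a \<Rightarrow> nat) topology" where
  "character_topology S =
     subtopology (product_topology (\<lambda>e. discrete_topology {0, 1}) (idempotents S)) (characters S)"

definition char_dom :: "'a sgrp \<Rightarrow> 'a \<Rightarrow> ('a \<Rightarrow> nat) set" where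
  "char_dom S e = {\<xi> \<in> characters S. \<xi> e = 1}"

definition spectral_action :: "'a sgrp \<Rightarrow> 'a \<Rightarrow> ('a \<Rightarrow> nat) \<Rightarrow> ('a \<Rightarrow> nat)" where
  "spectral_action S s \<xi> = (\<lambda>e \<in> idempotents S. \<xi> (star S s \<cdot>\<^bsub>S\<^esub> e \<cdot>\<^bsub>S\<^esub> s))"


section \<open>Etale groupoids\<close>

text \<open>Arrows and units live in separate types; each unit \<open>x\<close> is identified with the arrow
  \<open>ident G x\<close>. The arrows and units are the points of the two topologies. The value of \<open>comp G a b\<close>
  matters only if \<open>src G a = rng G b\<close>.\<close>

record ('g, 'x) groupoid =
  arrow_top :: "'g topology"
  unit_top :: "'x topology"
  src :: "'g \<Rightarrow> 'x"
  rng :: "'g \<Rightarrow> 'x"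
  ident :: "'x \<Rightarrow> 'g"
  comp :: "'g \<Rightarrow> 'g \<Rightarrow> 'g"
  ginv :: "'g \<Rightarrow> 'g"

abbreviation arrows :: "('g, 'x) groupoid \<Rightarrow> 'g set" where
  "arrows G \<equiv> topspace (arrow_top G)"

abbreviation units :: "('g, 'x) groupoid \<Rightarrow> 'x set" where
  "units G \<equiv> topspace (unit_top G)"

locale algebraic_groupoid =
  fixes G :: "('g, 'x) groupoid"
  assumes src_in: "a \<in> arrows G \<Longrightarrow> src G a \<in> units G"
    and rng_in: "a \<in> arrows G \<Longrightarrow> rng G a \<in> units G"
    and ident_in: "x \<in> units G \<Longrightarrow> ident G x \<in> arrows G"
    and src_ident: "x \<in> units G \<Longrightarrow> src G (ident G x) = x"
    and rng_ident: "x \<in> units G \<Longrightarrow> rng G (ident G x) = x"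
    and comp_in: "\<lbrakk>a \<in> arrows G; b \<in> arrows G; src G a = rng G b\<rbrakk> \<Longrightarrow> comp G a b \<in> arrows G"
    and src_comp: "\<lbrakk>a \<in> arrows G; b \<in> arrows G; src G a = rng G b\<rbrakk>
      \<Longrightarrow> src G (comp G a b) = src G b"
    and rng_comp: "\<lbrakk>a \<in> arrows G; b \<in> arrows G; src G a = rng G b\<rbrakk>
      \<Longrightarrow> rng G (comp G a b) = rng G a"
    and comp_assoc: "\<lbrakk>a \<in> arrows G; b \<in> arrows G; c \<in> arrows G; src G a = rng G b; src G b = rng G c\<rbrakk>
      \<Longrightarrow> comp G (comp G a b) c = comp G a (comp G b c)"
    and comp_ident_right: "a \<in> arrows G \<Longrightarrow> comp G a (ident G (src G a)) = a"
    and comp_ident_left: "a \<in> arrows G \<Longrightarrow> comp G (ident G (rng G a)) a = a"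
    and ginv_in: "a \<in> arrows G \<Longrightarrow> ginv G a \<in> arrows G"
    and src_ginv: "a \<in> arrows G \<Longrightarrow> src G (ginv G a) = rng G a"
    and rng_ginv: "a \<in> arrows G \<Longrightarrow> rng G (ginv G a) = src G a"
    and comp_ginv_left: "a \<in> arrows G \<Longrightarrow> comp G (ginv G a) a = ident G (src G a)"
    and comp_ginv_right: "a \<in> arrows G \<Longrightarrow> comp G a (ginv G a) = ident G (rng G a)"

definition composable :: "('g, 'x) groupoid \<Rightarrow> ('g \<times> 'g) set" where
  "composable G = {(a, b). a \<in> arrows G \<and> b \<in> arrows G \<and> src G a = rng G b}"

text \<open>As the range of \<open>ident\<close> carries the topology induced by the arrows (\<open>ident\<close> is continuous with
  continuous left inverse \<open>src\<close>), \<open>unit_top\<close> is the relative topology under the identification of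
  units with arrows.\<close>

locale topological_groupoid = algebraic_groupoid G for G :: "('g, 'x) groupoid" +
  assumes continuous_src: "continuous_map (arrow_top G) (unit_top G) (src G)"
    and continuous_rng: "continuous_map (arrow_top G) (unit_top G) (rng G)"
    and continuous_ident: "continuous_map (unit_top G) (arrow_top G) (ident G)"
    and continuous_comp:
      "continuous_map (subtopology (prod_topology (arrow_top G) (arrow_top G)) (composable G))
         (arrow_top G) (\<lambda>(a, b). comp G a b)"
    and continuous_ginv: "continuous_map (arrow_top G) (arrow_top G) (ginv G)"

definition local_homeomorphism :: "'a topology \<Rightarrow> 'b topology \<Rightarrow> ('a \<Rightarrow> 'b) \<Rightarrow> bool" where
  "local_homeomorphism X Y f \<longleftrightarrow>
     (\<forall>x \<in> topspace X. \<exists>U. openin X U \<and> x \<in> U \<and> openin Y (f ` U) \<and>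
        homeomorphic_map (subtopology X U) (subtopology Y (f ` U)) f)"

locale etale_groupoid = topological_groupoid G for G :: "('g, 'x) groupoid" +
  assumes local_homeomorphism_src: "local_homeomorphism (arrow_top G) (unit_top G) (src G)"

definition etale_groupoid_iso ::
  "('g, 'x) groupoid \<Rightarrow> ('h, 'y) groupoid \<Rightarrow> ('g \<Rightarrow> 'h) \<Rightarrow> ('x \<Rightarrow> 'y) \<Rightarrow> bool" where
  "etale_groupoid_iso G K \<phi> \<psi> \<longleftrightarrow>
     etale_groupoid G \<and> etale_groupoid K \<and>
     homeomorphic_map (arrow_top G) (arrow_top K) \<phi> \<and>
     homeomorphic_map (unit_top G) (unit_top K) \<psi> \<and>
     (\<forall>a \<in> arrows G. src K (\<phi> a) = \<psi> (src G a) \<and> rng K (\<phi> a) = \<psi> (rng G a) \<and>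
        \<phi> (ginv G a) = ginv K (\<phi> a)) \<and>
     (\<forall>x \<in> units G. \<phi> (ident G x) = ident K (\<psi> x)) \<and>
     (\<forall>(a, b) \<in> composable G. \<phi> (comp G a b) = comp K (\<phi> a) (\<phi> b))"

definition isomorphic_etale_groupoids ::
  "('g, 'x) groupoid \<Rightarrow> ('h, 'y) groupoid \<Rightarrow> bool"  (infix "\<cong>\<^sub>e" 50) where
  "G \<cong>\<^sub>e K \<longleftrightarrow> (\<exists>\<phi> \<psi>. etale_groupoid_iso G K \<phi> \<psi>)"

text \<open>For an invariant set \<open>F\<close> of units, sources in \<open>F\<close> force ranges in \<open>F\<close>.\<close>

definition restrict_groupoid :: "('g, 'x) groupoid \<Rightarrow> 'x set \<Rightarrow> ('g, 'x) groupoid" where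
  "restrict_groupoid G F =
     G\<lparr> arrow_top := subtopology (arrow_top G) {a \<in> arrows G. src G a \<in> F},
        unit_top := subtopology (unit_top G) F \<rparr>"

definition quotient_topology :: "'a topology \<Rightarrow> ('a \<times> 'a) set \<Rightarrow> 'a set topology" where
  "quotient_topology X R =
     topology (\<lambda>U. U \<subseteq> topspace X // R \<and> openin X {x \<in> topspace X. R `` {x} \<in> U})"

lemma openin_quotient_topology:
  "openin (quotient_topology X R) U \<longleftrightarrow>
     U \<subseteq> topspace X // R \<and> openin X {x \<in> topspace X. R `` {x} \<in> U}"
proof -
  have "istopology (\<lambda>U. U \<subseteq> topspace X // R \<and> openin X {x \<in> topspace X. R `` {x} \<in> U})"
    unfolding istopology_def
  proof (intro conjI allI impI)
    fix U V
    assume U: "U \<subseteq> topspace X // R \<and> openin X {x \<in> topspace X. R `` {x} \<in> U}"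
      and V: "V \<subseteq> topspace X // R \<and> openin X {x \<in> topspace X. R `` {x} \<in> V}"
    show "U \<inter> V \<subseteq> topspace X // R" using U by blast
    have "{x \<in> topspace X. R `` {x} \<in> U \<inter> V} =
        {x \<in> topspace X. R `` {x} \<in> U} \<inter> {x \<in> topspace X. R `` {x} \<in> V}" by blast
    then show "openin X {x \<in> topspace X. R `` {x} \<in> U \<inter> V}" using U V by (simp only: openin_Int)
  next
    fix \<U>
    assume *: "\<forall>U\<in>\<U>. U \<subseteq> topspace X // R \<and> openin X {x \<in> topspace X. R `` {x} \<in> U}"
    show "\<Union>\<U> \<subseteq> topspace X // R" using * by blast
    have "{x \<in> topspace X. R `` {x} \<in> \<Union>\<U>} = (\<Union>U\<in>\<U>. {x \<in> topspace X. R `` {x} \<in> U})" by blast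
    moreover have "openin X (\<Union>U\<in>\<U>. {x \<in> topspace X. R `` {x} \<in> U})"
      using * by (intro openin_Union) blast
    ultimately show "openin X {x \<in> topspace X. R `` {x} \<in> \<Union>\<U>}" by simp
  qed
  then show ?thesis
    unfolding quotient_topology_def by (rule topology_inverse'[THEN fun_cong])
qed

text \<open>Here \<open>H\<close> is the set of arrows of an open normal subgroupoid of \<open>G\<close>.\<close>

definition quotient_rel :: "('g, 'x) groupoid \<Rightarrow> 'g set \<Rightarrow> ('g \<times> 'g) set" where
  "quotient_rel G H = {(a, b). a \<in> arrows G \<and> b \<in> arrows G \<and> src G a = src G b \<and>
     comp G a (ginv G b) \<in> H}"

definition quotient_groupoid :: "('g, 'x) groupoid \<Rightarrow> 'g set \<Rightarrow> ('g set, 'x) groupoid" where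
  "quotient_groupoid G H =
     \<lparr> arrow_top = quotient_topology (arrow_top G) (quotient_rel G H),
       unit_top = unit_top G,
       src = (\<lambda>A. the_elem (src G ` A)),
       rng = (\<lambda>A. the_elem (rng G ` A)),
       ident = (\<lambda>x. quotient_rel G H `` {ident G x}),
       comp = (\<lambda>A B. \<Union>a\<in>A. \<Union>b\<in>B. quotient_rel G H `` {comp G a b}),
       ginv = (\<lambda>A. \<Union>a\<in>A. quotient_rel G H `` {ginv G a}) \<rparr>"


section \<open>The universal groupoid\<close>

definition germ_rel :: "'a sgrp \<Rightarrow> (('a \<times> ('a \<Rightarrow> nat)) \<times> ('a \<times> ('a \<Rightarrow> nat))) set" where
  "germ_rel S = {((s, \<xi>), (t, \<eta>)). s \<in> carrier S \<and> t \<in> carrier S \<and>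
     \<xi> \<in> char_dom S (star S s \<cdot>\<^bsub>S\<^esub> s) \<and> \<eta> \<in> char_dom S (star S t \<cdot>\<^bsub>S\<^esub> t) \<and>
     \<xi> = \<eta> \<and> (\<exists>e \<in> idempotents S. \<xi> e = 1 \<and> s \<cdot>\<^bsub>S\<^esub> e = t \<cdot>\<^bsub>S\<^esub> e)}"

definition germ :: "'a sgrp \<Rightarrow> 'a \<Rightarrow> ('a \<Rightarrow> nat) \<Rightarrow> ('a \<times> ('a \<Rightarrow> nat)) set" where
  "germ S s \<xi> = germ_rel S `` {(s, \<xi>)}"

text \<open>The points of \<open>topology_generated_by \<B>\<close> are the elements of \<open>\<Union>\<B>\<close>; for the family below
  these are all classes \<open>germ S s \<xi>\<close> with \<open>\<xi> \<in> char_dom S (star S s \<cdot>\<^bsub>S\<^esub> s)\<close>.\<close>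

definition universal_groupoid ::
  "'a sgrp \<Rightarrow> (('a \<times> ('a \<Rightarrow> nat)) set, 'a \<Rightarrow> nat) groupoid" where
  "universal_groupoid S =
     \<lparr> arrow_top = topology_generated_by
         {germ S s ` U | s U. s \<in> carrier S \<and> U \<subseteq> char_dom S (star S s \<cdot>\<^bsub>S\<^esub> s) \<and>
            openin (character_topology S) U},
       unit_top = character_topology S,
       src = (\<lambda>A. the_elem (snd ` A)),
       rng = (\<lambda>A. the_elem ((\<lambda>(s, \<xi>). spectral_action S s \<xi>) ` A)),
       ident = (\<lambda>\<xi>. \<Union>e \<in> {e \<in> idempotents S. \<xi> e = 1}. germ S e \<xi>),
       comp = (\<lambda>A B. \<Union>(s, \<xi>) \<in> A. \<Union>(t, \<eta>) \<in> B. germ S (s \<cdot>\<^bsub>S\<^esub> t) \<eta>),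
       ginv = (\<lambda>A. \<Union>(s, \<xi>) \<in> A. germ S (star S s) (spectral_action S s \<xi>)) \<rparr>"

text \<open>For a subsemigroup \<open>H\<close> of \<open>S\<close> containing the idempotents, every class of \<open>germ_rel H\<close> lies in a
  unique class of \<open>germ_rel S\<close>. The map below sends \<open>germ H s \<xi>\<close> to \<open>germ S s \<xi>\<close>; it identifies the
  universal groupoid of \<open>H\<close> with an open subgroupoid of that of \<open>S\<close>.\<close>

definition germ_inclusion ::
  "'a sgrp \<Rightarrow> ('a \<times> ('a \<Rightarrow> nat)) set \<Rightarrow> ('a \<times> ('a \<Rightarrow> nat)) set" where
  "germ_inclusion S A = germ_rel S `` A"

definition congruence_characters :: "'a sgrp \<Rightarrow> ('a \<times> 'a) set \<Rightarrow> ('a \<Rightarrow> nat) set" where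
  "congruence_characters S \<nu> =
     {\<lambda>e \<in> idempotents S. \<xi> (\<nu> `` {e}) | \<xi>. \<xi> \<in> characters (quotient_sgrp S \<nu>)}"

definition kernel_subgroupoid ::
  "'a sgrp \<Rightarrow> ('a \<times> 'a) set \<Rightarrow> ('a \<times> ('a \<Rightarrow> nat)) set set" where
  "kernel_subgroupoid S \<nu> = germ_inclusion S `
     arrows (restrict_groupoid (universal_groupoid (kernel_sgrp S \<nu>)) (congruence_characters S \<nu>))"

end

theory Submission
  imports Defs
begin

text \<open>
  The quotient map \<open>q\<close> identifies the characters of \<open>S/\<nu>\<close> with \<open>F\<^sub>\<nu>\<close> by \<open>\<xi> \<mapsto> \<xi> \<circ> q\<close>, a homeomorphism because
  every idempotent of \<open>S/\<nu>\<close> lifts to an idempotent of \<open>S\<close>. Hence \<open>[s, \<xi> \<circ> q] \<mapsto> [q s, \<xi>]\<close> is a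
  surjective morphism from the restriction of \<open>G\<^sub>u(S)\<close> to \<open>F\<^sub>\<nu>\<close> onto \<open>G\<^sub>u(S/\<nu>)\<close>. It is continuous and
  open, since it maps bisections to bisections, and it is bijective on units. If \<open>[q s, \<xi>]\<close> is a
  unit, then \<open>q (s e)\<close> is idempotent for some \<open>e \<in> E(S)\<close> with \<open>\<xi> (q e) = 1\<close>, so that
  \<open>[s, \<xi> \<circ> q] = [s e, \<xi> \<circ> q]\<close> with \<open>s e \<in> ker \<nu>\<close>. So the kernel is the restriction of \<open>G\<^sub>u(ker \<nu>)\<close>, and
  the first isomorphism theorem for groupoids applies.
\<close>

section \<open>Inverse semigroups\<close>

text \<open>Operations on classes are unions over all representatives, so each becomes usable only
  once independence of the representatives is known. The lemmas on \<open>agree\<close> supply this,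
  each with an explicit idempotent witness. That idempotents of S/nu lift has to be shown before
  S/nu is known to be an inverse semigroup, because commutation of its idempotents is deduced from
  the lifting. The etale axioms are proved for the universal groupoid of an arbitrary inverse
  semigroup and never directly for the quotient groupoid. The isomorphism runs from G_u(S/nu) to the
  quotient and sends an arrow to its fibre under \<open>\<pi>\<close>. Since \<open>\<pi>\<close> is
  a quotient map, this is a homeomorphism, and it carries the axioms over. On the side of S, only
  the algebra of the restricted groupoid then enters, together with the quotient map. Bijectivity on
  units is what makes the quotient relation equal to having the same image under
  \<open>\<pi>\<close>.\<close>

lemma image_eq_singletonI:
  assumes "a \<in> A" "\<And>x. x \<in> A \<Longrightarrow> f x = c"
  shows "f ` A = {c}"
  using assms by blast

text \<open>The form in which operations on classes are evaluated: one representative shows that the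
  family is nonempty, and independence of the representative shows that it is constant.\<close>

lemma UN_eqI:
  assumes "a \<in> A" "\<And>x. x \<in> A \<Longrightarrow> f x = C"
  shows "(\<Union>x\<in>A. f x) = C"
  using assms by blast

lemma UN_UN_eqI:
  assumes "a \<in> A" "b \<in> B" "\<And>x y. x \<in> A \<Longrightarrow> y \<in> B \<Longrightarrow> f x y = C"
  shows "(\<Union>x\<in>A. \<Union>y\<in>B. f x y) = C"
  using assms by blast

text \<open>The classical criterion: a regular semigroup whose idempotents commute has unique
  inverses. In a quotient or a subsemigroup, commuting idempotents are easier to verify than
  uniqueness.\<close>

lemma inverse_semigroupI:
  fixes S :: "'a sgrp" (structure)
  assumes closed: "\<And>x y. x \<in> carrier S \<Longrightarrow> y \<in> carrier S \<Longrightarrow> x \<cdot> y \<in> carrier S"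
    and assoc: "\<And>x y z. x \<in> carrier S \<Longrightarrow> y \<in> carrier S \<Longrightarrow> z \<in> carrier S
      \<Longrightarrow> x \<cdot> y \<cdot> z = x \<cdot> (y \<cdot> z)"
    and regular: "\<And>x. x \<in> carrier S \<Longrightarrow> \<exists>y \<in> carrier S. x \<cdot> y \<cdot> x = x \<and> y \<cdot> x \<cdot> y = y"
    and comm: "\<And>x y. x \<in> carrier S \<Longrightarrow> y \<in> carrier S \<Longrightarrow> x \<cdot> x = x \<Longrightarrow> y \<cdot> y = y
      \<Longrightarrow> x \<cdot> y = y \<cdot> x"
  shows "inverse_semigroup S"
proof
  fix x assume x: "x \<in> carrier S"
  show "\<exists>!y. y \<in> carrier S \<and> x = x \<cdot> y \<cdot> x \<and> y = y \<cdot> x \<cdot> y"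
  proof (rule ex_ex1I)
    show "\<exists>y. y \<in> carrier S \<and> x = x \<cdot> y \<cdot> x \<and> y = y \<cdot> x \<cdot> y"
      using regular[OF x] by auto
  next
    fix y z
    assume y: "y \<in> carrier S \<and> x = x \<cdot> y \<cdot> x \<and> y = y \<cdot> x \<cdot> y"
      and z: "z \<in> carrier S \<and> x = x \<cdot> z \<cdot> x \<and> z = z \<cdot> x \<cdot> z"
    \<comment> \<open>Cancellation rules valid for any inverse \<open>w\<close> of \<open>x\<close>,
      in right-nested form; they are instantiated with both candidates \<open>y\<close> and
      \<open>z\<close>.\<close>
    have inv: "w \<cdot> x \<cdot> (w \<cdot> x) = w \<cdot> x" "x \<cdot> w \<cdot> (x \<cdot> w) = x \<cdot> w"
      "\<And>u. u \<in> carrier S \<Longrightarrow> x \<cdot> (w \<cdot> (x \<cdot> u)) = x \<cdot> u" "x \<cdot> (w \<cdot> x) = x" "w \<cdot> (x \<cdot> w) = w"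
      "\<And>u. u \<in> carrier S \<Longrightarrow> w \<cdot> (x \<cdot> (w \<cdot> u)) = w \<cdot> u"
      if w: "w \<in> carrier S \<and> x = x \<cdot> w \<cdot> x \<and> w = w \<cdot> x \<cdot> w" for w
    proof -
      from w have c: "w \<in> carrier S" and "x \<cdot> w \<cdot> x = x" "w \<cdot> x \<cdot> w = w" by auto
      then show xwx: "x \<cdot> (w \<cdot> x) = x" and wxw: "w \<cdot> (x \<cdot> w) = w"
        using x by (simp_all add: assoc)
      show "x \<cdot> (w \<cdot> (x \<cdot> u)) = x \<cdot> u" if "u \<in> carrier S" for u
        using arg_cong[OF xwx, of "\<lambda>z. z \<cdot> u"] c x that by (simp add: assoc closed)
      show "w \<cdot> (x \<cdot> (w \<cdot> u)) = w \<cdot> u" if "u \<in> carrier S" for u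
        using arg_cong[OF wxw, of "\<lambda>z. z \<cdot> u"] c x that by (simp add: assoc closed)
      show "w \<cdot> x \<cdot> (w \<cdot> x) = w \<cdot> x" "x \<cdot> w \<cdot> (x \<cdot> w) = x \<cdot> w"
        using c x by (simp_all add: assoc closed xwx wxw)
    qed
    note Y = inv[OF y] and Z = inv[OF z]
    have yc: "y \<in> carrier S" and zc: "z \<in> carrier S" using y z by auto
    \<comment> \<open>Replacing \<open>x\<close> by \<open>x z x\<close> in \<open>y x y\<close>
      produces the idempotents \<open>x z\<close> and \<open>x y\<close>, which are then swapped.
      The mirror computation for \<open>z\<close> swaps \<open>z x\<close> and \<open>y x\<close>;
      both reduce to \<open>y x z\<close>.\<close>
    have "y = y \<cdot> ((x \<cdot> z) \<cdot> (x \<cdot> y))"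
      using x yc zc by (simp add: assoc closed Y(3-6) Z(3-6))
    also have "(x \<cdot> z) \<cdot> (x \<cdot> y) = (x \<cdot> y) \<cdot> (x \<cdot> z)"
      by (intro comm closed Y Z x yc zc)
    also have "y \<cdot> ((x \<cdot> y) \<cdot> (x \<cdot> z)) = y \<cdot> (x \<cdot> z)"
      using x yc zc by (simp add: assoc closed Y(3-6) Z(3-6))
    finally have 1: "y = y \<cdot> (x \<cdot> z)" .
    have "z = ((z \<cdot> x) \<cdot> (y \<cdot> x)) \<cdot> z"
      using x yc zc by (simp add: assoc closed Y(3-6) Z(3-6))
    also have "(z \<cdot> x) \<cdot> (y \<cdot> x) = (y \<cdot> x) \<cdot> (z \<cdot> x)"
      by (intro comm closed Y Z x yc zc)
    also have "((y \<cdot> x) \<cdot> (z \<cdot> x)) \<cdot> z = y \<cdot> (x \<cdot> z)"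
      using x yc zc by (simp add: assoc closed Y(3-6) Z(3-6))
    finally show "y = z" using 1 by simp
  qed
qed (fact closed assoc)+

context inverse_semigroup
begin

lemma star_props:
  assumes "s \<in> carrier S"
  shows star_closed: "star S s \<in> carrier S"
    and mult_star_mult: "s \<cdot> star S s \<cdot> s = s"
    and star_mult_star: "star S s \<cdot> s \<cdot> star S s = star S s"
  using theI'[OF unique_inverse[OF assms]] unfolding star_def by auto

lemma star_eqI:
  assumes "s \<in> carrier S" "t \<in> carrier S" "s \<cdot> t \<cdot> s = s" "t \<cdot> s \<cdot> t = t"
  shows "star S s = t"
  unfolding star_def using assms by (intro the1_equality[OF unique_inverse]) auto

lemma idem_closed: "e \<in> idempotents S \<Longrightarrow> e \<in> carrier S"
  and idem_idem: "e \<in> idempotents S \<Longrightarrow> e \<cdot> e = e"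
  by (auto simp: idempotents_def)

lemma idem_idem_left: "e \<in> idempotents S \<Longrightarrow> s \<in> carrier S \<Longrightarrow> e \<cdot> (e \<cdot> s) = e \<cdot> s"
  by (metis idem_closed idem_idem mult_assoc)

lemma idem_star: "e \<in> idempotents S \<Longrightarrow> star S e = e"
  by (rule star_eqI) (auto simp: idem_closed idem_idem)

lemma star_star: "s \<in> carrier S \<Longrightarrow> star S (star S s) = s"
  by (rule star_eqI) (auto simp: star_props)

text \<open>Associativity and closure only; commutativity is available just for idempotents.\<close>

lemmas ac = mult_assoc mult_closed star_closed

text \<open>The variants with a trailing factor \<open>u\<close> cancel in the middle of a
  right-nested product.\<close>

lemma mult_star_mult_left:
  "s \<in> carrier S \<Longrightarrow> s \<cdot> (star S s \<cdot> s) = s"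
  "s \<in> carrier S \<Longrightarrow> u \<in> carrier S \<Longrightarrow> s \<cdot> (star S s \<cdot> (s \<cdot> u)) = s \<cdot> u"
  using mult_star_mult by (metis mult_assoc star_closed mult_closed)+

lemma star_mult_star_left:
  "s \<in> carrier S \<Longrightarrow> star S s \<cdot> (s \<cdot> star S s) = star S s"
  "s \<in> carrier S \<Longrightarrow> u \<in> carrier S \<Longrightarrow> star S s \<cdot> (s \<cdot> (star S s \<cdot> u)) = star S s \<cdot> u"
  using star_mult_star by (metis mult_assoc star_closed mult_closed)+

lemmas stars = mult_star_mult_left star_mult_star_left

lemma mult_star_idem: "s \<in> carrier S \<Longrightarrow> s \<cdot> star S s \<in> idempotents S"
  and star_mult_idem: "s \<in> carrier S \<Longrightarrow> star S s \<cdot> s \<in> idempotents S"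
  by (auto simp: idempotents_def ac stars)

text \<open>With \<open>x = (ef)\<^sup>*\<close>, also \<open>fxe\<close> is an inverse of \<open>ef\<close>, so \<open>x = fxe\<close> is idempotent,
  and hence so is \<open>ef = x\<^sup>*\<close>.\<close>

lemma idem_mult:
  assumes e: "e \<in> idempotents S" and f: "f \<in> idempotents S"
  shows "e \<cdot> f \<in> idempotents S"
proof -
  define x where "x = star S (e \<cdot> f)"
  note [simp] = idem_closed[OF e] idem_closed[OF f] idem_idem_left[OF e] idem_idem_left[OF f]
    idem_idem[OF e] idem_idem[OF f]
  have [simp]: "x \<in> carrier S" by (simp add: x_def ac)
  have 1: "e \<cdot> (f \<cdot> (x \<cdot> (e \<cdot> f))) = e \<cdot> f"
    using mult_star_mult[of "e \<cdot> f"] by (simp add: ac flip: x_def)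
  have 2: "x \<cdot> (e \<cdot> (f \<cdot> x)) = x"
    using star_mult_star[of "e \<cdot> f"] by (simp add: ac flip: x_def)
  have 3: "x \<cdot> (e \<cdot> (f \<cdot> (x \<cdot> e))) = x \<cdot> e"
    using arg_cong[OF 2, of "\<lambda>z. z \<cdot> e"] by (simp add: ac)
  have x: "x = f \<cdot> (x \<cdot> e)"
    unfolding x_def by (rule star_eqI) (simp_all add: ac 1 2 3 flip: x_def)
  have "x \<cdot> x = f \<cdot> (x \<cdot> (e \<cdot> (f \<cdot> (x \<cdot> e))))"
    by (subst (1 2) x) (simp add: ac)
  also have "\<dots> = x"
    by (simp only: 3) (rule x[symmetric])
  finally have "x \<in> idempotents S" by (simp add: idempotents_def)
  then have "star S x = x" by (rule idem_star)
  moreover have "star S x = e \<cdot> f"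
    by (simp add: x_def star_star ac)
  ultimately show ?thesis using \<open>x \<in> idempotents S\<close> by simp
qed

text \<open>As \<open>e f\<close> and \<open>f e\<close> are idempotent, \<open>f e\<close> is an
  inverse of \<open>e f\<close>; but an idempotent is its own inverse, and inverses are
  unique.\<close>

lemma idem_commute:
  assumes e: "e \<in> idempotents S" and f: "f \<in> idempotents S"
  shows "e \<cdot> f = f \<cdot> e"
proof -
  note [simp] = idem_closed[OF e] idem_closed[OF f] idem_idem_left[OF e] idem_idem_left[OF f]
  have ef: "e \<cdot> (f \<cdot> (e \<cdot> f)) = e \<cdot> f" and fe: "f \<cdot> (e \<cdot> (f \<cdot> e)) = f \<cdot> e"
    using idem_idem[OF idem_mult[OF e f]] idem_idem[OF idem_mult[OF f e]] by (simp_all add: ac)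
  have "star S (e \<cdot> f) = f \<cdot> e"
    by (rule star_eqI) (simp_all add: ac ef fe)
  then show ?thesis
    using idem_star[OF idem_mult[OF e f]] by simp
qed

lemma idem_commute_left:
  "\<lbrakk>e \<in> idempotents S; f \<in> idempotents S; s \<in> carrier S\<rbrakk> \<Longrightarrow> e \<cdot> (f \<cdot> s) = f \<cdot> (e \<cdot> s)"
  by (metis idem_closed idem_commute mult_assoc)

text \<open>The idempotents \<open>s* s\<close> and \<open>t t*\<close> meet in the middle of the
  products to be checked; once swapped, they are absorbed by the neighbouring factors.\<close>

lemma star_mult_eq:
  assumes s: "s \<in> carrier S" and t: "t \<in> carrier S"
  shows "star S (s \<cdot> t) = star S t \<cdot> star S s"
proof (rule star_eqI)
  let ?e = "star S s \<cdot> s" and ?f = "t \<cdot> star S t"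
  have c: "?e \<cdot> ?f = ?f \<cdot> ?e"
    by (intro idem_commute mult_star_idem star_mult_idem s t)
  have "s \<cdot> t \<cdot> (star S t \<cdot> star S s) \<cdot> (s \<cdot> t) = s \<cdot> (?f \<cdot> ?e) \<cdot> t"
    using s t by (simp add: ac)
  also have "\<dots> = s \<cdot> t"
    using s t by (simp add: ac stars flip: c)
  finally show "s \<cdot> t \<cdot> (star S t \<cdot> star S s) \<cdot> (s \<cdot> t) = s \<cdot> t" .
  have "star S t \<cdot> star S s \<cdot> (s \<cdot> t) \<cdot> (star S t \<cdot> star S s) = star S t \<cdot> (?e \<cdot> ?f) \<cdot> star S s"
    using s t by (simp add: ac)
  also have "\<dots> = star S t \<cdot> star S s"
    using s t by (simp add: ac stars c)
  finally show "star S t \<cdot> star S s \<cdot> (s \<cdot> t) \<cdot> (star S t \<cdot> star S s) = star S t \<cdot> star S s" .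
qed (use s t in \<open>simp_all add: ac\<close>)

text \<open>Both parts move \<open>e\<close> past the idempotent \<open>s* s\<close>, which the
  adjacent \<open>s\<close> or \<open>s*\<close> then absorbs.\<close>

lemma idem_swap:
  assumes s: "s \<in> carrier S" and e: "e \<in> idempotents S"
  shows "s \<cdot> (e \<cdot> (star S s \<cdot> s)) = s \<cdot> e"
    and "star S s \<cdot> (s \<cdot> (e \<cdot> star S s)) = e \<cdot> star S s"
proof -
  have "e \<cdot> (star S s \<cdot> s) = (star S s \<cdot> s) \<cdot> e"
    by (intro idem_commute star_mult_idem s e)
  then show 1: "s \<cdot> (e \<cdot> (star S s \<cdot> s)) = s \<cdot> e"
    using s idem_closed[OF e] by (simp add: ac stars)
  have "star S s \<cdot> (s \<cdot> (e \<cdot> star S s)) = (star S s \<cdot> s) \<cdot> (e \<cdot> star S s)"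
    using s idem_closed[OF e] by (simp add: ac)
  also have "\<dots> = e \<cdot> ((star S s \<cdot> s) \<cdot> star S s)"
    by (intro idem_commute_left star_mult_idem star_closed s e)
  finally show "star S s \<cdot> (s \<cdot> (e \<cdot> star S s)) = e \<cdot> star S s"
    using s idem_closed[OF e] by (simp add: ac stars)
qed

lemma idem_conj:
  assumes s: "s \<in> carrier S" and e: "e \<in> idempotents S"
  shows "s \<cdot> e \<cdot> star S s \<in> idempotents S"
  using s idem_closed[OF e] by (simp add: idempotents_def ac idem_swap(2)[OF s e] idem_idem_left[OF e])

lemma idem_conj':
  "s \<in> carrier S \<Longrightarrow> e \<in> idempotents S \<Longrightarrow> star S s \<cdot> e \<cdot> s \<in> idempotents S"
  using idem_conj[of "star S s" e] by (simp add: star_star star_closed)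

end

section \<open>The quotient by a congruence is an inverse semigroup\<close>

locale semigroup_congruence = inverse_semigroup S for S :: "'a sgrp" (structure) +
  fixes \<nu> :: "('a \<times> 'a) set"
  assumes congruence: "sgrp_congruence S \<nu>"
begin

definition T :: "'a set sgrp" where "T = quotient_sgrp S \<nu>"

definition q :: "'a \<Rightarrow> 'a set" where "q s = \<nu> `` {s}"

lemma equiv: "equiv (carrier S) \<nu>"
  using congruence by (simp add: sgrp_congruence_def)

lemma carrier_T: "carrier T = q ` carrier S"
  by (auto simp: T_def q_def quotient_sgrp_def quotient_def)

lemma q_closed: "s \<in> carrier S \<Longrightarrow> q s \<in> carrier T"
  by (simp add: carrier_T)

text \<open>A congruence is compatible with multiplication on one side at a time, so the two
  representatives are exchanged one after the other, by way of \<open>s' t\<close>.\<close>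

lemma q_mult:
  assumes "s \<in> carrier S" "t \<in> carrier S"
  shows "q s \<cdot>\<^bsub>T\<^esub> q t = q (s \<cdot> t)"
proof -
  have *: "\<nu> `` {s' \<cdot> t'} = \<nu> `` {s \<cdot> t}" if "(s, s') \<in> \<nu>" "(t, t') \<in> \<nu>" for s' t'
  proof -
    have "s' \<in> carrier S" "t' \<in> carrier S"
      using that equiv by (auto simp: equiv_def refl_on_def)
    then have "(s \<cdot> t, s' \<cdot> t) \<in> \<nu>" "(s' \<cdot> t, s' \<cdot> t') \<in> \<nu>"
      using that assms congruence by (auto simp: sgrp_congruence_def)
    then have "(s \<cdot> t, s' \<cdot> t') \<in> \<nu>"
      using equiv by (meson equiv_def transE)
    then show ?thesis
      using equiv_class_eq[OF equiv] by metis
  qed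
  have "s \<in> \<nu> `` {s}" "t \<in> \<nu> `` {t}"
    using assms[THEN equiv_class_self[OF equiv]] .
  then have "(\<Union>s'\<in>\<nu> `` {s}. \<Union>t'\<in>\<nu> `` {t}. \<nu> `` {s' \<cdot> t'}) = \<nu> `` {s \<cdot> t}"
    using * by (intro UN_UN_eqI) blast+
  then show ?thesis
    by (simp add: T_def q_def quotient_sgrp_def)
qed

text \<open>Lallement's lemma, with lift \<open>e = s r s\<close> for \<open>r = (s s)*\<close>.
  Since \<open>s\<close> and \<open>s s\<close> have the same class, so do \<open>s r s\<close> and
  \<open>(s s) r (s s) = s s\<close>. Only inverses in \<open>S\<close> are used, so the lemma is
  available before \<open>T\<close> is known to be inverse.\<close>

lemma lift_idempotent:
  assumes x: "x \<in> carrier T" "x \<cdot>\<^bsub>T\<^esub> x = x"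
  shows "\<exists>e \<in> idempotents S. q e = x"
proof -
  obtain s where s: "s \<in> carrier S" "x = q s"
    using x by (auto simp: carrier_T)
  define r where "r = star S (s \<cdot> s)"
  have r: "r \<in> carrier S" "r \<cdot> (s \<cdot> (s \<cdot> r)) = r" "s \<cdot> (s \<cdot> (r \<cdot> (s \<cdot> s))) = s \<cdot> s"
    using star_mult_star[of "s \<cdot> s"] mult_star_mult[of "s \<cdot> s"] s by (auto simp: r_def ac)
  have "r \<cdot> (s \<cdot> (s \<cdot> (r \<cdot> s))) = r \<cdot> s"
    using arg_cong[OF r(2), of "\<lambda>z. z \<cdot> s"] s r(1) by (simp add: ac)
  then have e: "s \<cdot> r \<cdot> s \<in> idempotents S"
    using s r(1) by (simp add: idempotents_def ac)
  have ss: "q (s \<cdot> s) = q s"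
    using x s by (simp add: q_mult)
  have "q (s \<cdot> r \<cdot> s) = q s \<cdot>\<^bsub>T\<^esub> q r \<cdot>\<^bsub>T\<^esub> q s"
    using s r(1) by (simp add: q_mult ac)
  also have "\<dots> = q (s \<cdot> s) \<cdot>\<^bsub>T\<^esub> q r \<cdot>\<^bsub>T\<^esub> q (s \<cdot> s)"
    by (simp add: ss)
  also have "\<dots> = q (s \<cdot> s)"
    using s r by (simp add: q_mult ac)
  finally show ?thesis
    using e ss s by auto
qed

text \<open>The class of \<open>s*\<close> is an inverse of the class of \<open>s\<close>; two
  idempotents commute because they lift to idempotents of \<open>S\<close>, which commute.\<close>

lemma inverse_semigroup_T: "inverse_semigroup T"
proof (rule inverse_semigroupI)
  fix x y assume x: "x \<in> carrier T" and y: "y \<in> carrier T"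
  then show "x \<cdot>\<^bsub>T\<^esub> y \<in> carrier T" by (auto simp: carrier_T q_mult ac)
  show "x \<cdot>\<^bsub>T\<^esub> y \<cdot>\<^bsub>T\<^esub> z = x \<cdot>\<^bsub>T\<^esub> (y \<cdot>\<^bsub>T\<^esub> z)" if "z \<in> carrier T" for z
    using x y that by (auto simp: carrier_T q_mult ac)
  show "\<exists>y \<in> carrier T. x \<cdot>\<^bsub>T\<^esub> y \<cdot>\<^bsub>T\<^esub> x = x \<and> y \<cdot>\<^bsub>T\<^esub> x \<cdot>\<^bsub>T\<^esub> y = y"
  proof -
    obtain s where "s \<in> carrier S" "x = q s" using x by (auto simp: carrier_T)
    then show ?thesis
      by (intro bexI[of _ "q (star S s)"]) (simp_all add: q_mult q_closed ac stars)
  qed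
  show "x \<cdot>\<^bsub>T\<^esub> y = y \<cdot>\<^bsub>T\<^esub> x" if xx: "x \<cdot>\<^bsub>T\<^esub> x = x" and yy: "y \<cdot>\<^bsub>T\<^esub> y = y"
  proof -
    obtain e f where ef: "e \<in> idempotents S" "q e = x" "f \<in> idempotents S" "q f = y"
      using lift_idempotent[OF x xx] lift_idempotent[OF y yy] by blast
    show ?thesis
      using q_mult[of e f] q_mult[of f e] idem_commute[OF ef(1,3)]
      by (simp add: ef idem_closed[OF ef(1)] idem_closed[OF ef(3)])
  qed
qed

sublocale T: inverse_semigroup T
  by (rule inverse_semigroup_T)

lemma star_q: "s \<in> carrier S \<Longrightarrow> star T (q s) = q (star S s)"
  by (rule T.star_eqI) (simp_all add: q_closed q_mult ac stars)

lemma q_idem: "e \<in> idempotents S \<Longrightarrow> q e \<in> idempotents T"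
  by (auto simp: idempotents_def q_closed q_mult)

lemma idempotents_T: "idempotents T = q ` idempotents S"
proof
  show "q ` idempotents S \<subseteq> idempotents T" by (auto simp: q_idem)
  show "idempotents T \<subseteq> q ` idempotents S"
  proof
    fix x assume x: "x \<in> idempotents T"
    then obtain s where s: "s \<in> carrier S" "x = q s"
      using T.idem_closed by (auto simp: carrier_T)
    \<comment> \<open>An idempotent equals \<open>x* x\<close>, and this expression lifts to
      \<open>s* s\<close> for any representative \<open>s\<close>.\<close>
    have "x = star T x \<cdot>\<^bsub>T\<^esub> x"
      using T.idem_star[OF x] T.idem_idem[OF x] by simp
    also have "\<dots> = q (star S s \<cdot> s)"
      using s by (simp add: star_q q_mult star_closed)
    finally have "x = q (star S s \<cdot> s)" .
    then show "x \<in> q ` idempotents S"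
      using s by (simp add: star_mult_idem)
  qed
qed

end

section \<open>Germs and the universal groupoid\<close>

declare One_nat_def [simp del]

context inverse_semigroup
begin

abbreviation G :: "(('a \<times> ('a \<Rightarrow> nat)) set, 'a \<Rightarrow> nat) groupoid" where
  "G \<equiv> universal_groupoid S"

abbreviation act_dom :: "'a \<Rightarrow> ('a \<Rightarrow> nat) set" where
  "act_dom s \<equiv> char_dom S (star S s \<cdot> s)"

abbreviation \<beta> :: "'a \<Rightarrow> ('a \<Rightarrow> nat) \<Rightarrow> 'a \<Rightarrow> nat" where
  "\<beta> \<equiv> spectral_action S"

lemma character_mult:
  "\<lbrakk>\<xi> \<in> characters S; e \<in> idempotents S; f \<in> idempotents S\<rbrakk> \<Longrightarrow> \<xi> (e \<cdot> f) = \<xi> e * \<xi> f"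
  by (simp add: characters_def)

lemma character_01: "\<xi> \<in> characters S \<Longrightarrow> e \<in> idempotents S \<Longrightarrow> \<xi> e = 0 \<or> \<xi> e = 1"
  by (auto simp: characters_def PiE_iff)

lemma character_nonzero:
  assumes \<xi>: "\<xi> \<in> characters S" shows "\<exists>e \<in> idempotents S. \<xi> e = 1"
proof -
  obtain e where "e \<in> idempotents S" "\<xi> e \<noteq> 0"
    using \<xi> by (auto simp: characters_def)
  then show ?thesis
    using character_01[OF \<xi>, of e] by (intro bexI[of _ e]) auto
qed

lemma char_dom_characters: "\<xi> \<in> char_dom S e \<Longrightarrow> \<xi> \<in> characters S"
  by (simp add: char_dom_def)

lemma dom_idem: "e \<in> idempotents S \<Longrightarrow> act_dom e = char_dom S e"
  by (simp add: idem_star idem_idem)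

lemma spectral_action_apply: "e \<in> idempotents S \<Longrightarrow> \<beta> s \<xi> e = \<xi> (star S s \<cdot> e \<cdot> s)"
  by (simp add: spectral_action_def)

text \<open>The idempotent \<open>s s*\<close> between the two conjugates commutes with
  \<open>f\<close> and is absorbed by the final \<open>s\<close>. This is what makes
  \<open>\<beta> s \<xi>\<close> multiplicative.\<close>

lemma conj_mult:
  assumes s: "s \<in> carrier S" and e: "e \<in> idempotents S" and f: "f \<in> idempotents S"
  shows "star S s \<cdot> (e \<cdot> f) \<cdot> s = star S s \<cdot> e \<cdot> s \<cdot> (star S s \<cdot> f \<cdot> s)"
proof -
  note c = s idem_closed[OF e] idem_closed[OF f]
  have "star S s \<cdot> e \<cdot> s \<cdot> (star S s \<cdot> f \<cdot> s) = star S s \<cdot> (e \<cdot> ((s \<cdot> star S s) \<cdot> (f \<cdot> s)))"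
    using c by (simp add: ac)
  also have "(s \<cdot> star S s) \<cdot> (f \<cdot> s) = f \<cdot> ((s \<cdot> star S s) \<cdot> s)"
    using s f by (intro idem_commute_left mult_star_idem)
  finally show ?thesis
    using c by (simp add: ac stars)
qed

lemma spectral_action_char_dom:
  assumes s: "s \<in> carrier S" and \<xi>: "\<xi> \<in> act_dom s"
  shows "\<beta> s \<xi> \<in> char_dom S (s \<cdot> star S s)"
proof -
  have \<xi>': "\<xi> \<in> characters S" using \<xi> by (rule char_dom_characters)
  \<comment> \<open>Conjugating \<open>s s*\<close> gives back \<open>s* s\<close>, where
    \<open>\<xi>\<close> is 1; the same value shows that \<open>\<beta> s \<xi>\<close> is
    nonzero.\<close>
  have 1: "\<beta> s \<xi> (s \<cdot> star S s) = 1"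
    using s \<xi> by (simp add: spectral_action_apply mult_star_idem ac stars char_dom_def)
  have "\<beta> s \<xi> (e \<cdot> f) = \<beta> s \<xi> e * \<beta> s \<xi> f" if "e \<in> idempotents S" "f \<in> idempotents S" for e f
    using that s \<xi>'
    by (simp add: spectral_action_apply idem_mult conj_mult character_mult idem_conj')
  moreover have "\<beta> s \<xi> \<in> idempotents S \<rightarrow>\<^sub>E {0, 1}"
    using \<xi>' s character_01 idem_conj' by (fastforce simp: spectral_action_def)
  ultimately show ?thesis
    using 1 mult_star_idem[OF s] unfolding char_dom_def characters_def
    by (auto intro!: bexI[of _ "s \<cdot> star S s"])
qed

lemma spectral_action_characters: "s \<in> carrier S \<Longrightarrow> \<xi> \<in> act_dom s \<Longrightarrow> \<beta> s \<xi> \<in> characters S"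
  using spectral_action_char_dom char_dom_characters by blast

lemma spectral_action_dom_star: "s \<in> carrier S \<Longrightarrow> \<xi> \<in> act_dom s \<Longrightarrow> \<beta> s \<xi> \<in> act_dom (star S s)"
  using spectral_action_char_dom by (simp add: star_star)

text \<open>Off the idempotents both functions are \<open>undefined\<close>, so agreement on the
  idempotents suffices.\<close>

lemma character_eqI:
  assumes "\<xi> \<in> characters S" "\<eta> \<in> characters S" "\<And>e. e \<in> idempotents S \<Longrightarrow> \<xi> e = \<eta> e"
  shows "\<xi> = \<eta>"
  using assms by (intro PiE_ext[of _ "idempotents S" "\<lambda>_. {0, 1}"]) (auto simp: characters_def)

text \<open>The value at \<open>f\<close> is that of \<open>\<xi>\<close> at \<open>e f e\<close>,
  where the two factors \<open>\<xi> e\<close> are 1.\<close>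

lemma spectral_action_idem:
  assumes e: "e \<in> idempotents S" and \<xi>: "\<xi> \<in> char_dom S e"
  shows "\<beta> e \<xi> = \<xi>"
proof (rule character_eqI)
  have \<xi>e: "\<xi> \<in> act_dom e" using e \<xi> by (simp add: dom_idem)
  show "\<beta> e \<xi> \<in> characters S"
    using e \<xi>e by (intro spectral_action_characters idem_closed)
  show "\<xi> \<in> characters S" using \<xi> by (rule char_dom_characters)
  then show "\<beta> e \<xi> f = \<xi> f" if f: "f \<in> idempotents S" for f
    using e f \<xi> by (simp add: spectral_action_apply idem_star character_mult idem_mult char_dom_def)
qed

text \<open>Since \<open>(s t)* (s t) = t* (s* s) t\<close>, the value of \<open>\<xi>\<close> there
  is that of \<open>\<beta> t \<xi>\<close> at \<open>s* s\<close>.\<close>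

lemma dom_mult:
  assumes s: "s \<in> carrier S" and t: "t \<in> carrier S" and \<xi>: "\<xi> \<in> act_dom t" and \<beta>\<xi>: "\<beta> t \<xi> \<in> act_dom s"
  shows "\<xi> \<in> act_dom (s \<cdot> t)"
proof -
  have "\<beta> t \<xi> (star S s \<cdot> s) = 1" using \<beta>\<xi> by (simp add: char_dom_def)
  then show ?thesis
    using \<xi> s t by (simp add: spectral_action_apply star_mult_idem star_mult_eq char_dom_def ac)
qed

lemma spectral_action_mult:
  assumes s: "s \<in> carrier S" and t: "t \<in> carrier S" and \<xi>: "\<xi> \<in> act_dom t" and \<beta>\<xi>: "\<beta> t \<xi> \<in> act_dom s"
  shows "\<beta> (s \<cdot> t) \<xi> = \<beta> s (\<beta> t \<xi>)"
proof (rule character_eqI)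
  show "\<beta> (s \<cdot> t) \<xi> \<in> characters S" "\<beta> s (\<beta> t \<xi>) \<in> characters S"
    using assms dom_mult by (auto intro: spectral_action_characters simp: mult_closed)
  show "\<beta> (s \<cdot> t) \<xi> e = \<beta> s (\<beta> t \<xi>) e" if "e \<in> idempotents S" for e
    using s t that idem_closed[OF that] idem_conj'[OF s that]
    by (simp add: spectral_action_apply star_mult_eq ac)
qed

lemma spectral_action_star:
  assumes s: "s \<in> carrier S" and \<xi>: "\<xi> \<in> act_dom s"
  shows "\<beta> (star S s) (\<beta> s \<xi>) = \<xi>"
proof -
  have "\<beta> (star S s) (\<beta> s \<xi>) = \<beta> (star S s \<cdot> s) \<xi>"
    using s \<xi> by (intro spectral_action_mult[symmetric] spectral_action_dom_star star_closed)
  then show ?thesis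
    using s \<xi> by (simp add: spectral_action_idem star_mult_idem)
qed

section \<open>Germs at a fixed character and their compatibility with star and product\<close>

definition agree :: "'a \<Rightarrow> 'a \<Rightarrow> ('a \<Rightarrow> nat) \<Rightarrow> bool" where
  "agree s t \<xi> \<longleftrightarrow> (\<exists>e \<in> idempotents S. \<xi> e = 1 \<and> s \<cdot> e = t \<cdot> e)"

lemma germ_rel_iff:
  "((s, \<xi>), (t, \<eta>)) \<in> germ_rel S \<longleftrightarrow>
     s \<in> carrier S \<and> t \<in> carrier S \<and> \<xi> \<in> act_dom s \<and> \<xi> \<in> act_dom t \<and> \<eta> = \<xi> \<and> agree s t \<xi>"
  by (auto simp: germ_rel_def agree_def)

lemma agree_refl: "\<xi> \<in> characters S \<Longrightarrow> agree s s \<xi>"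
  using character_nonzero[of \<xi>] by (auto simp: agree_def)

lemma agree_sym: "agree s t \<xi> \<Longrightarrow> agree t s \<xi>"
  by (auto simp: agree_def)

text \<open>The product of the two witnesses is a witness, because idempotents commute and
  \<open>\<xi>\<close> is multiplicative.\<close>

lemma agree_trans:
  assumes \<xi>: "\<xi> \<in> characters S" and c: "s \<in> carrier S" "t \<in> carrier S" "u \<in> carrier S"
    and "agree s t \<xi>" "agree t u \<xi>"
  shows "agree s u \<xi>"
proof -
  from assms obtain e f where e: "e \<in> idempotents S" "\<xi> e = 1" "s \<cdot> e = t \<cdot> e"
    and f: "f \<in> idempotents S" "\<xi> f = 1" "t \<cdot> f = u \<cdot> f"
    by (auto simp: agree_def)
  have "s \<cdot> (e \<cdot> f) = (t \<cdot> e) \<cdot> f"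
    using c e idem_closed[OF e(1)] idem_closed[OF f(1)] by (simp add: e(3)[symmetric] mult_assoc)
  also have "\<dots> = (t \<cdot> f) \<cdot> e"
    using c idem_closed[OF e(1)] idem_closed[OF f(1)] idem_commute[OF e(1) f(1)]
    by (simp add: mult_assoc)
  also have "\<dots> = u \<cdot> (e \<cdot> f)"
    using c idem_closed[OF e(1)] idem_closed[OF f(1)] idem_commute[OF e(1) f(1)]
    by (simp add: mult_assoc f(3))
  finally show ?thesis
    using e f \<xi> unfolding agree_def by (intro bexI[of _ "e \<cdot> f"]) (auto simp: character_mult idem_mult)
qed

lemma germ_eq_iff:
  assumes "s \<in> carrier S" "t \<in> carrier S" "\<xi> \<in> act_dom s" "\<eta> \<in> act_dom t"
  shows "germ S s \<xi> = germ S t \<eta> \<longleftrightarrow> \<xi> = \<eta> \<and> agree s t \<xi>"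
proof
  assume "germ S s \<xi> = germ S t \<eta>"
  moreover have "(t, \<eta>) \<in> germ S t \<eta>"
    using assms by (auto simp: germ_def germ_rel_iff intro: agree_refl char_dom_characters)
  ultimately have "(t, \<eta>) \<in> germ S s \<xi>" by simp
  then show "\<xi> = \<eta> \<and> agree s t \<xi>"
    by (auto simp: germ_def germ_rel_iff)
next
  assume *: "\<xi> = \<eta> \<and> agree s t \<xi>"
  have "\<xi> \<in> characters S" using assms by (simp add: char_dom_def)
  then have "((s, \<xi>), x) \<in> germ_rel S \<longleftrightarrow> ((t, \<xi>), x) \<in> germ_rel S" for x
    using * assms by (cases x) (metis germ_rel_iff agree_trans agree_sym)
  then show "germ S s \<xi> = germ S t \<eta>"
    using * unfolding germ_def by blast
qed

lemma germ_self: "s \<in> carrier S \<Longrightarrow> \<xi> \<in> act_dom s \<Longrightarrow> (s, \<xi>) \<in> germ S s \<xi>"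
  by (auto simp: germ_def germ_rel_iff intro: agree_refl char_dom_characters)

lemma germ_memD:
  "(t, \<eta>) \<in> germ S s \<xi> \<Longrightarrow> t \<in> carrier S \<and> \<eta> = \<xi> \<and> \<xi> \<in> act_dom t \<and> agree s t \<xi>"
  by (auto simp: germ_def germ_rel_iff)

text \<open>When \<open>\<xi> e = 1\<close>, replacing \<open>s\<close> by \<open>s e\<close> does
  not change the action at \<open>\<xi>\<close>: it turns \<open>s* f s\<close> into
  \<open>e (s* f s) e\<close>, which has the same value. Then \<open>s e = t e\<close>
  applies.\<close>

lemma agree_spectral_action:
  assumes c: "s \<in> carrier S" "t \<in> carrier S" and \<xi>: "\<xi> \<in> act_dom s" "\<xi> \<in> act_dom t" and st: "agree s t \<xi>"
  shows "\<beta> s \<xi> = \<beta> t \<xi>"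
proof (rule character_eqI)
  show "\<beta> s \<xi> \<in> characters S" "\<beta> t \<xi> \<in> characters S"
    using c \<xi> by (auto intro: spectral_action_characters)
  fix f assume f: "f \<in> idempotents S"
  obtain e where e: "e \<in> idempotents S" "\<xi> e = 1" "s \<cdot> e = t \<cdot> e"
    using st by (auto simp: agree_def)
  have \<xi>': "\<xi> \<in> characters S" using \<xi> by (simp add: char_dom_def)
  have *: "\<beta> u \<xi> f = \<xi> (star S (u \<cdot> e) \<cdot> f \<cdot> (u \<cdot> e))" if u: "u \<in> carrier S" for u
  proof -
    have "star S (u \<cdot> e) \<cdot> f \<cdot> (u \<cdot> e) = e \<cdot> (star S u \<cdot> f \<cdot> u) \<cdot> e"
      using u idem_closed[OF f] idem_closed[OF e(1)] by (simp add: star_mult_eq idem_star[OF e(1)] ac)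
    then show ?thesis
      using u f e \<xi>' by (simp add: spectral_action_apply character_mult idem_mult idem_conj')
  qed
  show "\<beta> s \<xi> f = \<beta> t \<xi> f"
    using *[of s] *[of t] c e(3) by simp
qed

text \<open>The witness is \<open>s e s* = (s e) (s e)*\<close>, and its product with
  \<open>s*\<close> is \<open>(s e)*\<close>. Both depend only on \<open>s e = t e\<close>, so
  \<open>t\<close> gives the same elements.\<close>

lemma agree_star:
  assumes c: "s \<in> carrier S" "t \<in> carrier S" and \<xi>: "\<xi> \<in> act_dom s" and st: "agree s t \<xi>"
  shows "agree (star S s) (star S t) (\<beta> s \<xi>)"
proof -
  obtain e where e: "e \<in> idempotents S" "\<xi> e = 1" "s \<cdot> e = t \<cdot> e"
    using st by (auto simp: agree_def)
  have \<xi>': "\<xi> \<in> characters S" "\<xi> (star S s \<cdot> s) = 1" using \<xi> by (auto simp: char_dom_def)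
  note ec = idem_closed[OF e(1)]
  let ?f = "s \<cdot> e \<cdot> star S s"
  have f: "?f \<in> idempotents S" using c e by (intro idem_conj)
  have "\<beta> s \<xi> ?f = \<xi> (star S s \<cdot> s \<cdot> e \<cdot> (star S s \<cdot> s))"
    using c ec f by (simp add: spectral_action_apply ac)
  also have "\<dots> = 1"
    using \<xi>' e c by (simp add: character_mult idem_mult star_mult_idem)
  finally have 1: "\<beta> s \<xi> ?f = 1" .
  have *: "star S u \<cdot> (u \<cdot> e \<cdot> star S u) = star S (u \<cdot> e)"
    "(u \<cdot> e) \<cdot> star S (u \<cdot> e) = u \<cdot> e \<cdot> star S u" if u: "u \<in> carrier S" for u
    using u ec idem_swap(2)[OF u e(1)] idem_idem_left[OF e(1)]
    by (simp_all add: ac star_mult_eq idem_star[OF e(1)])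
  have "?f = t \<cdot> e \<cdot> star S t"
    using *(2)[of s] *(2)[of t] c e(3) by metis
  then have "star S s \<cdot> ?f = star S t \<cdot> ?f"
    using *(1)[of s] *(1)[of t] c e(3) by metis
  then show ?thesis
    using f 1 by (auto simp: agree_def)
qed

text \<open>The witness is \<open>f (t* e t)\<close>. Since \<open>t (t* e t) = e t\<close>, the
  second factor brings \<open>e\<close> next to \<open>s\<close>, while \<open>f\<close> exchanges
  \<open>t\<close> for \<open>t'\<close>. Its value is 1 because \<open>\<xi> (t* e t)\<close> is
  \<open>\<beta> t \<xi> e\<close>.\<close>

lemma agree_mult:
  assumes c: "s \<in> carrier S" "s' \<in> carrier S" "t \<in> carrier S" "t' \<in> carrier S"
    and \<xi>: "\<xi> \<in> act_dom t" and ss: "agree s s' (\<beta> t \<xi>)" and tt: "agree t t' \<xi>"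
  shows "agree (s \<cdot> t) (s' \<cdot> t') \<xi>"
proof -
  obtain e f where e: "e \<in> idempotents S" "\<beta> t \<xi> e = 1" "s \<cdot> e = s' \<cdot> e"
    and f: "f \<in> idempotents S" "\<xi> f = 1" "t \<cdot> f = t' \<cdot> f"
    using ss tt by (auto simp: agree_def)
  have \<xi>': "\<xi> \<in> characters S" using \<xi> by (auto simp: char_dom_def)
  note cc = c idem_closed[OF e(1)] idem_closed[OF f(1)]
  let ?g = "star S t \<cdot> e \<cdot> t"
  have g: "?g \<in> idempotents S" using c e by (intro idem_conj')
  have tg: "t \<cdot> ?g = e \<cdot> t"
    using idem_swap(2)[of "star S t" e] c cc e by (simp add: star_star ac)
  have et: "e \<cdot> t \<cdot> f = e \<cdot> t' \<cdot> f"
    using cc f(3) by (simp add: ac)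
  have "s \<cdot> t \<cdot> (?g \<cdot> f) = s \<cdot> (t \<cdot> ?g) \<cdot> f"
    using cc by (simp add: ac)
  also have "\<dots> = (s \<cdot> e) \<cdot> t \<cdot> f"
    unfolding tg using cc by (simp add: ac)
  also have "\<dots> = s' \<cdot> (e \<cdot> t) \<cdot> f"
    unfolding e(3) using cc by (simp add: ac)
  also have "\<dots> = s' \<cdot> t \<cdot> (?g \<cdot> f)"
    unfolding tg[symmetric] using cc by (simp add: ac)
  also have "?g \<cdot> f = f \<cdot> ?g" using f(1) g by (intro idem_commute)
  also have "s' \<cdot> t \<cdot> (f \<cdot> ?g) = s' \<cdot> (t \<cdot> f) \<cdot> ?g"
    using cc by (simp add: ac)
  also have "\<dots> = s' \<cdot> t' \<cdot> (f \<cdot> ?g)"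
    unfolding f(3) using cc by (simp add: ac)
  finally have "s \<cdot> t \<cdot> (f \<cdot> ?g) = s' \<cdot> t' \<cdot> (f \<cdot> ?g)"
    by (simp add: idem_commute[OF f(1) g])
  moreover have "\<xi> (f \<cdot> ?g) = 1"
    using f e g \<xi>' by (simp add: character_mult spectral_action_apply)
  ultimately show ?thesis
    unfolding agree_def using idem_mult[OF f(1) g] by blast
qed

text \<open>The witness is \<open>e f\<close>, below both idempotents. Hence the unit at
  \<open>\<xi>\<close> may be written with any idempotent on which \<open>\<xi>\<close> is
  1.\<close>

lemma agree_idem:
  assumes "e \<in> idempotents S" "f \<in> idempotents S" "\<xi> \<in> characters S" "\<xi> e = 1" "\<xi> f = 1"
  shows "agree e f \<xi>"
proof -
  have "e \<cdot> (e \<cdot> f) = f \<cdot> (e \<cdot> f)"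
    using assms idem_commute_left[of f e f] by (simp add: idem_idem idem_idem_left idem_closed)
  then show ?thesis
    using assms unfolding agree_def by (intro bexI[of _ "e \<cdot> f"]) (auto simp: character_mult idem_mult)
qed

lemma germ_cong:
  "\<lbrakk>s \<in> carrier S; t \<in> carrier S; \<xi> \<in> act_dom s; \<xi> \<in> act_dom t; agree s t \<xi>\<rbrakk> \<Longrightarrow> germ S s \<xi> = germ S t \<xi>"
  by (simp add: germ_eq_iff)

section \<open>Arrows, units and structure maps of the universal groupoid\<close>

lemma topspace_characters: "topspace (character_topology S) = characters S"
  by (auto simp: character_topology_def characters_def)

lemma continuous_map_eval:
  assumes "e \<in> idempotents S"
  shows "continuous_map (character_topology S) (discrete_topology {0, 1}) (\<lambda>\<xi>. \<xi> e)"
  unfolding character_topology_def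
  by (intro continuous_map_from_subtopology continuous_map_product_projection assms)

lemma openin_char_dom:
  assumes e: "e \<in> idempotents S"
  shows "openin (character_topology S) (char_dom S e)"
proof -
  have "openin (character_topology S) {\<xi> \<in> topspace (character_topology S). \<xi> e \<in> {1}}"
    using continuous_map_eval[OF e] by (rule openin_continuous_map_preimage) simp
  then show ?thesis
    by (simp add: char_dom_def topspace_characters)
qed

lemma openin_dom: "s \<in> carrier S \<Longrightarrow> openin (character_topology S) (act_dom s)"
  by (intro openin_char_dom star_mult_idem)

lemma arrows_G: "arrows G = {germ S s \<xi> | s \<xi>. s \<in> carrier S \<and> \<xi> \<in> act_dom s}"
proof -
  have "arrows G = \<Union>{germ S s ` U | s U. s \<in> carrier S \<and> U \<subseteq> act_dom s \<and> openin (character_topology S) U}"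
    by (simp add: universal_groupoid_def)
  then show ?thesis using openin_dom by blast
qed

lemma units_G: "units G = characters S"
  by (simp add: universal_groupoid_def topspace_characters)

lemma unit_top_G: "unit_top G = character_topology S"
  by (simp add: universal_groupoid_def)

lemma arrow_cases:
  assumes "a \<in> arrows G"
  obtains s \<xi> where "s \<in> carrier S" "\<xi> \<in> act_dom s" "a = germ S s \<xi>"
  using assms by (auto simp: arrows_G)

lemma germ_in_arrows: "s \<in> carrier S \<Longrightarrow> \<xi> \<in> act_dom s \<Longrightarrow> germ S s \<xi> \<in> arrows G"
  by (auto simp: arrows_G)

lemma src_germ:
  assumes "s \<in> carrier S" "\<xi> \<in> act_dom s" shows "src G (germ S s \<xi>) = \<xi>"
proof -
  have "snd ` germ S s \<xi> = {\<xi>}"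
    using germ_self[OF assms] by (rule image_eq_singletonI) (auto dest: germ_memD)
  then show ?thesis by (simp add: universal_groupoid_def)
qed

lemma rng_germ:
  assumes "s \<in> carrier S" "\<xi> \<in> act_dom s" shows "rng G (germ S s \<xi>) = \<beta> s \<xi>"
proof -
  have "(\<lambda>(s, \<xi>). \<beta> s \<xi>) ` germ S s \<xi> = {\<beta> s \<xi>}"
    using germ_self[OF assms]
    by (rule image_eq_singletonI)
      (use assms in \<open>auto dest!: germ_memD intro: agree_spectral_action[symmetric]\<close>)
  then show ?thesis by (simp add: universal_groupoid_def)
qed

lemma ident_eq_germ:
  assumes "\<xi> \<in> characters S" "e \<in> idempotents S" "\<xi> e = 1"
  shows "ident G \<xi> = germ S e \<xi>"
proof -
  have *: "germ S f \<xi> = germ S e \<xi>" if "f \<in> idempotents S" "\<xi> f = 1" for f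
    using that assms by (intro germ_cong idem_closed agree_idem) (auto simp: idem_star idem_idem char_dom_def)
  have "(\<Union>f \<in> {f \<in> idempotents S. \<xi> f = 1}. germ S f \<xi>) = germ S e \<xi>"
    by (rule UN_eqI[of e]) (use assms in simp, rule *, auto)
  then show ?thesis by (simp add: universal_groupoid_def)
qed

lemma comp_germ:
  assumes s: "s \<in> carrier S" and t: "t \<in> carrier S" and \<xi>: "\<xi> \<in> act_dom t" and \<beta>\<xi>: "\<beta> t \<xi> \<in> act_dom s"
  shows "comp G (germ S s (\<beta> t \<xi>)) (germ S t \<xi>) = germ S (s \<cdot> t) \<xi>"
proof -
  have *: "germ S (s' \<cdot> t') \<eta> = germ S (s \<cdot> t) \<xi>"
    if s': "(s', \<zeta>) \<in> germ S s (\<beta> t \<xi>)" and t': "(t', \<eta>) \<in> germ S t \<xi>" for s' \<zeta> t' \<eta>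
  proof -
    have s': "s' \<in> carrier S" "\<zeta> = \<beta> t \<xi>" "\<beta> t \<xi> \<in> act_dom s'" "agree s s' (\<beta> t \<xi>)"
      and t': "t' \<in> carrier S" "\<eta> = \<xi>" "\<xi> \<in> act_dom t'" "agree t t' \<xi>"
      using germ_memD[OF s'] germ_memD[OF t'] by auto
    \<comment> \<open>Exchanging \<open>t\<close> for \<open>t'\<close> does not move the range, so
      \<open>s'\<close> is still defined there and \<open>s' t'\<close> represents a germ at
      \<open>\<xi>\<close>.\<close>
    have \<beta>: "\<beta> t \<xi> = \<beta> t' \<xi>"
      by (intro agree_spectral_action t \<xi> t')
    have "\<xi> \<in> act_dom (s' \<cdot> t')"
      by (intro dom_mult s' t') (simp only: s' flip: \<beta>)
    then have "germ S (s \<cdot> t) \<xi> = germ S (s' \<cdot> t') \<xi>"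
      by (intro germ_cong mult_closed agree_mult dom_mult[OF s t] s t s' t' \<xi> \<beta>\<xi>)
    then show ?thesis by (simp only: t')
  qed
  have "(\<Union>x \<in> germ S s (\<beta> t \<xi>). \<Union>y \<in> germ S t \<xi>. germ S (fst x \<cdot> fst y) (snd y))
      = germ S (s \<cdot> t) \<xi>"
    using germ_self[OF s \<beta>\<xi>] germ_self[OF t \<xi>]
    by (rule UN_UN_eqI) (clarify, simp only: fst_conv snd_conv, rule *)
  then show ?thesis by (simp add: universal_groupoid_def case_prod_unfold)
qed

lemma ginv_germ:
  assumes s: "s \<in> carrier S" and \<xi>: "\<xi> \<in> act_dom s"
  shows "ginv G (germ S s \<xi>) = germ S (star S s) (\<beta> s \<xi>)"
proof -
  have *: "germ S (star S t) (\<beta> t \<eta>) = germ S (star S s) (\<beta> s \<xi>)"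
    if t: "(t, \<eta>) \<in> germ S s \<xi>" for t \<eta>
  proof -
    have t: "t \<in> carrier S" "\<eta> = \<xi>" "\<xi> \<in> act_dom t" "agree s t \<xi>"
      using germ_memD[OF t] by auto
    have \<beta>: "\<beta> s \<xi> = \<beta> t \<xi>"
      by (intro agree_spectral_action s \<xi> t)
    have "germ S (star S s) (\<beta> s \<xi>) = germ S (star S t) (\<beta> s \<xi>)"
      by (intro germ_cong star_closed agree_star spectral_action_dom_star s \<xi> t)
        (simp only: \<beta> spectral_action_dom_star t)
    then show ?thesis by (simp only: \<beta> t)
  qed
  have "(\<Union>(t, \<eta>) \<in> germ S s \<xi>. germ S (star S t) (\<beta> t \<eta>)) = germ S (star S s) (\<beta> s \<xi>)"
    using germ_self[OF assms] by (rule UN_eqI) (clarify, rule *)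
  then show ?thesis by (simp add: universal_groupoid_def)
qed

text \<open>Composability forces the character of the first germ to be
  \<open>\<beta> t \<xi>\<close>, which gives the pair the shape required by
  \<open>comp_germ\<close>.\<close>

lemma arrow_pair_cases:
  assumes "a \<in> arrows G" "b \<in> arrows G" "src G a = rng G b"
  obtains s t \<xi> where "s \<in> carrier S" "t \<in> carrier S" "\<xi> \<in> act_dom t" "\<beta> t \<xi> \<in> act_dom s"
    "a = germ S s (\<beta> t \<xi>)" "b = germ S t \<xi>"
proof -
  obtain s \<zeta> where s: "s \<in> carrier S" "\<zeta> \<in> act_dom s" "a = germ S s \<zeta>"
    using assms(1) by (rule arrow_cases)
  obtain t \<xi> where t: "t \<in> carrier S" "\<xi> \<in> act_dom t" "b = germ S t \<xi>"
    using assms(2) by (rule arrow_cases)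
  have "\<zeta> = \<beta> t \<xi>"
    using assms(3) s t by (simp add: src_germ rng_germ)
  then show ?thesis using s t that by blast
qed

lemma ident_germ:
  assumes "\<xi> \<in> characters S"
  obtains e where "e \<in> idempotents S" "\<xi> e = 1" "\<xi> \<in> act_dom e" "ident G \<xi> = germ S e \<xi>"
proof -
  obtain e where e: "e \<in> idempotents S" "\<xi> e = 1"
    using character_nonzero[OF assms] by blast
  then have "\<xi> \<in> act_dom e"
    using assms by (simp add: idem_star idem_idem char_dom_def)
  then show ?thesis
    using that[OF e] ident_eq_germ[OF assms e] by blast
qed

lemma ident_germ_star_mult:
  assumes s: "s \<in> carrier S" and \<xi>: "\<xi> \<in> act_dom s"
  shows "ident G \<xi> = germ S (star S s \<cdot> s) \<xi>"
  using \<xi> s by (intro ident_eq_germ) (auto simp: char_dom_def star_mult_idem)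

lemma algebraic_groupoid_G: "algebraic_groupoid G"
proof
  fix a assume a: "a \<in> arrows G"
  then obtain s \<xi> where s: "s \<in> carrier S" and \<xi>: "\<xi> \<in> act_dom s" and a_eq: "a = germ S s \<xi>"
    by (rule arrow_cases)
  note s' = star_closed[OF s] and \<xi>' = spectral_action_dom_star[OF s \<xi>]
  have \<beta>\<xi>: "\<beta> s \<xi> \<in> characters S" using s \<xi> by (rule spectral_action_characters)
  show "src G a \<in> units G" "rng G a \<in> units G"
    using s \<xi> by (simp_all add: a_eq src_germ rng_germ units_G char_dom_characters \<beta>\<xi>)
  have ginv: "ginv G a = germ S (star S s) (\<beta> s \<xi>)"
    unfolding a_eq using s \<xi> by (rule ginv_germ)
  show "ginv G a \<in> arrows G"
    unfolding ginv using s' \<xi>' by (rule germ_in_arrows)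
  show "src G (ginv G a) = rng G a" "rng G (ginv G a) = src G a"
    using s \<xi> s' \<xi>' unfolding ginv unfolding a_eq by (simp_all add: src_germ rng_germ spectral_action_star)
  have "comp G (ginv G a) a = germ S (star S s \<cdot> s) \<xi>"
    unfolding ginv unfolding a_eq using s' s \<xi> \<xi>' by (rule comp_germ)
  then show "comp G (ginv G a) a = ident G (src G a)"
    using s \<xi> by (simp add: a_eq src_germ ident_germ_star_mult)
  \<comment> \<open>The character \<open>\<xi>\<close> is rewritten as the image of
    \<open>\<beta> s \<xi>\<close> under \<open>s*\<close>, so that the product has the shape of
    \<open>comp_germ\<close>.\<close>
  have "comp G (germ S s (\<beta> (star S s) (\<beta> s \<xi>))) (ginv G a) = germ S (s \<cdot> star S s) (\<beta> s \<xi>)"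
    unfolding ginv using s s' \<xi>' by (rule comp_germ) (simp only: spectral_action_star[OF s \<xi>] \<xi>)
  then have "comp G a (ginv G a) = germ S (s \<cdot> star S s) (\<beta> s \<xi>)"
    by (simp only: spectral_action_star[OF s \<xi>] flip: a_eq)
  moreover have "ident G (\<beta> s \<xi>) = germ S (s \<cdot> star S s) (\<beta> s \<xi>)"
    using ident_germ_star_mult[OF s' \<xi>'] by (simp add: star_star s)
  ultimately show "comp G a (ginv G a) = ident G (rng G a)"
    using s \<xi> by (simp add: a_eq rng_germ)
  have \<beta>e: "\<beta> (star S s \<cdot> s) \<xi> = \<xi>"
    using s \<xi> by (intro spectral_action_idem star_mult_idem)
  have \<xi>e: "\<xi> \<in> act_dom (star S s \<cdot> s)"
    using s \<xi> by (simp add: dom_idem star_mult_idem)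
  have "comp G (germ S s (\<beta> (star S s \<cdot> s) \<xi>)) (germ S (star S s \<cdot> s) \<xi>) = germ S (s \<cdot> (star S s \<cdot> s)) \<xi>"
    by (rule comp_germ) (simp_all only: s \<xi> \<xi>e \<beta>e mult_closed s')
  then show "comp G a (ident G (src G a)) = a"
    using s \<xi> by (simp only: a_eq src_germ ident_germ_star_mult \<beta>e stars)
  \<comment> \<open>This is \<open>s s*\<close>, written as the source idempotent of
    \<open>s*\<close>, so that the description of units at sources also gives the unit at the range
    of \<open>s\<close>.\<close>
  let ?f = "star S (star S s) \<cdot> star S s"
  have f: "?f \<in> idempotents S" using s' by (rule star_mult_idem)
  have \<beta>f: "\<beta> s \<xi> \<in> act_dom ?f"
    using \<xi>' by (simp add: dom_idem[OF f])
  have "comp G (germ S ?f (\<beta> s \<xi>)) (germ S s \<xi>) = germ S (?f \<cdot> s) \<xi>"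
    using idem_closed[OF f] s \<xi> \<beta>f by (rule comp_germ)
  moreover have "?f \<cdot> s = s"
    using s by (simp add: star_star ac stars)
  ultimately show "comp G (ident G (rng G a)) a = a"
    by (simp only: a_eq rng_germ[OF s \<xi>] ident_germ_star_mult[OF s' \<xi>'])
next
  fix \<xi> assume \<xi>: "\<xi> \<in> units G"
  then obtain e where e: "e \<in> idempotents S" "\<xi> e = 1" "\<xi> \<in> act_dom e" "ident G \<xi> = germ S e \<xi>"
    using ident_germ by (auto simp: units_G)
  note c = idem_closed[OF e(1)]
  show "ident G \<xi> \<in> arrows G" "src G (ident G \<xi>) = \<xi>" "rng G (ident G \<xi>) = \<xi>"
    using c e by (simp_all only: germ_in_arrows src_germ rng_germ)
      (simp_all add: spectral_action_idem idem_star idem_idem)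
next
  fix a b assume a: "a \<in> arrows G" and b: "b \<in> arrows G" and ab: "src G a = rng G b"
  then obtain s t \<xi> where s: "s \<in> carrier S" and t: "t \<in> carrier S" and \<xi>: "\<xi> \<in> act_dom t"
    and \<beta>\<xi>: "\<beta> t \<xi> \<in> act_dom s" and a_eq: "a = germ S s (\<beta> t \<xi>)" and b_eq: "b = germ S t \<xi>"
    by (rule arrow_pair_cases)
  have comp: "comp G a b = germ S (s \<cdot> t) \<xi>"
    unfolding a_eq b_eq using s t \<xi> \<beta>\<xi> by (rule comp_germ)
  note st = mult_closed[OF s t] and \<xi>st = dom_mult[OF s t \<xi> \<beta>\<xi>]
  show "comp G a b \<in> arrows G"
    unfolding comp using st \<xi>st by (rule germ_in_arrows)
  show "src G (comp G a b) = src G b" "rng G (comp G a b) = rng G a"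
    unfolding comp using st \<xi>st s t \<xi> \<beta>\<xi>
    by (simp_all only: src_germ rng_germ a_eq b_eq spectral_action_mult)
  fix c assume c: "c \<in> arrows G" and bc: "src G b = rng G c"
  obtain u \<eta> where u: "u \<in> carrier S" and \<eta>: "\<eta> \<in> act_dom u" and c_eq: "c = germ S u \<eta>"
    using c by (rule arrow_cases)
  have \<xi>\<eta>: "\<xi> = \<beta> u \<eta>"
    using bc t \<xi> u \<eta> by (simp add: b_eq c_eq src_germ rng_germ)
  have \<eta>tu: "\<eta> \<in> act_dom (t \<cdot> u)" and \<beta>\<eta>: "\<beta> (t \<cdot> u) \<eta> = \<beta> t (\<beta> u \<eta>)"
    using dom_mult[OF t u \<eta>] spectral_action_mult[OF t u \<eta>] \<xi> by (simp_all add: \<xi>\<eta>)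
  have 1: "comp G (comp G a b) c = germ S (s \<cdot> t \<cdot> u) \<eta>"
    unfolding comp c_eq \<xi>\<eta> using st u \<eta> \<xi>st unfolding \<xi>\<eta> by (rule comp_germ)
  have "comp G b c = germ S (t \<cdot> u) \<eta>"
    unfolding b_eq c_eq \<xi>\<eta> using t u \<eta> \<xi> unfolding \<xi>\<eta> by (rule comp_germ)
  moreover have "comp G (germ S s (\<beta> (t \<cdot> u) \<eta>)) (germ S (t \<cdot> u) \<eta>) = germ S (s \<cdot> (t \<cdot> u)) \<eta>"
    by (rule comp_germ[OF s mult_closed[OF t u] \<eta>tu]) (use \<beta>\<xi> in \<open>simp only: \<beta>\<eta> \<xi>\<eta>\<close>)
  ultimately have "comp G a (comp G b c) = germ S (s \<cdot> (t \<cdot> u)) \<eta>"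
    by (simp only: a_eq \<beta>\<eta> \<xi>\<eta>)
  then show "comp G (comp G a b) c = comp G a (comp G b c)"
    using s t u by (simp add: 1 mult_assoc)
qed

sublocale G: algebraic_groupoid G
  by (rule algebraic_groupoid_G)

section \<open>Topology of the universal groupoid: etaleness\<close>

definition basic_opens :: "('a \<times> ('a \<Rightarrow> nat)) set set set" where
  "basic_opens = {germ S s ` U | s U. s \<in> carrier S \<and> U \<subseteq> act_dom s \<and> openin (character_topology S) U}"

lemma arrow_top_G: "arrow_top G = topology_generated_by basic_opens"
  by (simp add: universal_groupoid_def basic_opens_def)

lemma openin_germs:
  "\<lbrakk>s \<in> carrier S; U \<subseteq> act_dom s; openin (character_topology S) U\<rbrakk> \<Longrightarrow> openin (arrow_top G) (germ S s ` U)"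
  unfolding arrow_top_G by (rule topology_generated_by_Basis) (auto simp: basic_opens_def)

text \<open>An idempotent witnessing agreement at \<open>\<xi>\<close> does so at every character on
  which it is 1, and these form an open set.\<close>

lemma agree_nhd:
  assumes s: "s \<in> carrier S" and t: "t \<in> carrier S" and \<xi>: "\<xi> \<in> act_dom s" "\<xi> \<in> act_dom t"
    and st: "agree s t \<xi>"
  obtains W where "openin (character_topology S) W" "\<xi> \<in> W" "W \<subseteq> act_dom s \<inter> act_dom t"
    "\<And>\<eta>. \<eta> \<in> W \<Longrightarrow> germ S s \<eta> = germ S t \<eta>"
proof -
  obtain e where e: "e \<in> idempotents S" "\<xi> e = 1" "s \<cdot> e = t \<cdot> e"
    using st by (auto simp: agree_def)
  let ?W = "act_dom s \<inter> act_dom t \<inter> char_dom S e"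
  have "openin (character_topology S) ?W"
    using s t e by (intro openin_Int openin_dom openin_char_dom)
  moreover have "\<xi> \<in> ?W" using \<xi> e by (auto simp: char_dom_def)
  moreover have "germ S s \<eta> = germ S t \<eta>" if "\<eta> \<in> ?W" for \<eta>
    using that s t e by (intro germ_cong) (auto simp: agree_def char_dom_def)
  ultimately show ?thesis using that by blast
qed

text \<open>The given sets are only declared to generate the topology. The induction over generated
  open sets shows that near a germ it suffices to look at the section of the chosen representative
  \<open>s\<close>; a generator built from another representative \<open>t\<close> is traded for
  \<open>s\<close> by \<open>agree_nhd\<close>.\<close>

lemma openin_arrowsD:
  assumes "openin (arrow_top G) A" and "s \<in> carrier S" and "\<xi> \<in> act_dom s" and "germ S s \<xi> \<in> A"
  obtains W where "openin (character_topology S) W" "\<xi> \<in> W" "W \<subseteq> act_dom s" "germ S s ` W \<subseteq> A"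
proof -
  have "generate_topology_on basic_opens A"
    using assms(1) by (simp add: arrow_top_G openin_topology_generated_by_iff)
  then have "\<exists>W. openin (character_topology S) W \<and> \<xi> \<in> W \<and> W \<subseteq> act_dom s \<and> germ S s ` W \<subseteq> A"
    using \<open>germ S s \<xi> \<in> A\<close>
  proof (induction rule: generate_topology_on.induct)
    case Empty
    then show ?case by simp
  next
    case (Int A B)
    then obtain V W where "openin (character_topology S) V \<and> \<xi> \<in> V \<and> V \<subseteq> act_dom s \<and> germ S s ` V \<subseteq> A"
      and "openin (character_topology S) W \<and> \<xi> \<in> W \<and> W \<subseteq> act_dom s \<and> germ S s ` W \<subseteq> B" by auto
    then show ?case by (intro exI[of _ "V \<inter> W"]) auto
  next
    case (UN K)
    then show ?case by (meson Sup_upper UnionE subset_trans)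
  next
    case (Basis B)
    then obtain t U where t: "t \<in> carrier S" and U: "U \<subseteq> act_dom t" "openin (character_topology S) U"
      and B: "B = germ S t ` U"
      by (auto simp: basic_opens_def)
    then obtain \<eta> where "\<eta> \<in> U" "germ S s \<xi> = germ S t \<eta>" using Basis by auto
    then have \<xi>: "\<xi> \<in> U" and st: "agree s t \<xi>"
      using assms(2,3) t U germ_eq_iff[of s t \<xi> \<eta>] by auto
    obtain W where W: "openin (character_topology S) W" "\<xi> \<in> W" "W \<subseteq> act_dom s \<inter> act_dom t"
      "\<And>\<eta>. \<eta> \<in> W \<Longrightarrow> germ S s \<eta> = germ S t \<eta>"
      by (rule agree_nhd[OF \<open>s \<in> carrier S\<close> t \<open>\<xi> \<in> act_dom s\<close> _ st]) (use \<xi> U in auto)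
    then show ?case
      using \<xi> U unfolding B by (intro exI[of _ "W \<inter> U"]) auto
  qed
  then show ?thesis using that by blast
qed

lemma openin_arrowsI:
  assumes "A \<subseteq> arrows G"
    and "\<And>s \<xi>. \<lbrakk>s \<in> carrier S; \<xi> \<in> act_dom s; germ S s \<xi> \<in> A\<rbrakk>
      \<Longrightarrow> \<exists>W. openin (character_topology S) W \<and> \<xi> \<in> W \<and> germ S s ` (W \<inter> act_dom s) \<subseteq> A"
  shows "openin (arrow_top G) A"
proof (subst openin_subopen, intro ballI)
  fix a assume "a \<in> A"
  then obtain s \<xi> where s: "s \<in> carrier S" "\<xi> \<in> act_dom s" "a = germ S s \<xi>"
    using assms(1) arrow_cases by blast
  with assms(2) \<open>a \<in> A\<close> obtain W
    where W: "openin (character_topology S) W" "\<xi> \<in> W" "germ S s ` (W \<inter> act_dom s) \<subseteq> A"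
    by blast
  have "openin (arrow_top G) (germ S s ` (W \<inter> act_dom s))"
    using W s by (intro openin_germs openin_Int openin_dom) auto
  then show "\<exists>B. openin (arrow_top G) B \<and> a \<in> B \<and> B \<subseteq> A"
    using W s by blast
qed

text \<open>Pointwise convergence is the topology induced by the evaluations, so one idempotent is
  tested at a time.\<close>

lemma continuous_map_into_characters:
  assumes "f \<in> topspace X \<rightarrow> characters S"
    and "\<And>e. e \<in> idempotents S \<Longrightarrow> continuous_map X (discrete_topology {0, 1}) (\<lambda>x. f x e)"
  shows "continuous_map X (character_topology S) f"
  unfolding character_topology_def continuous_map_in_subtopology continuous_map_componentwise
  using assms by (auto simp: characters_def PiE_def)

lemma continuous_spectral_action:
  assumes s: "s \<in> carrier S"
  shows "continuous_map (subtopology (character_topology S) (act_dom s)) (character_topology S) (\<beta> s)"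
proof (rule continuous_map_into_characters)
  show "\<beta> s \<in> topspace (subtopology (character_topology S) (act_dom s)) \<rightarrow> characters S"
    using s spectral_action_characters by auto
  fix e assume e: "e \<in> idempotents S"
  have "continuous_map (subtopology (character_topology S) (act_dom s)) (discrete_topology {0, 1})
      (\<lambda>\<xi>. \<xi> (star S s \<cdot> e \<cdot> s))"
    using s e by (intro continuous_map_from_subtopology continuous_map_eval idem_conj')
  then show "continuous_map (subtopology (character_topology S) (act_dom s)) (discrete_topology {0, 1})
      (\<lambda>\<xi>. \<beta> s \<xi> e)"
    using e by (simp add: spectral_action_apply)
qed

lemma openin_spectral_action_preimage:
  assumes s: "s \<in> carrier S" and V: "openin (character_topology S) V"
  shows "openin (character_topology S) {\<xi> \<in> act_dom s. \<beta> s \<xi> \<in> V}"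
proof -
  let ?X = "subtopology (character_topology S) (act_dom s)"
  have "act_dom s \<subseteq> topspace (character_topology S)"
    using openin_dom[OF s] by (rule openin_subset)
  then have "topspace ?X = act_dom s" by auto
  then have "openin ?X {\<xi> \<in> act_dom s. \<beta> s \<xi> \<in> V}"
    using openin_continuous_map_preimage[OF continuous_spectral_action[OF s] V] by simp
  then show ?thesis
    using openin_trans_full openin_dom[OF s] by blast
qed

text \<open>Every germ has a neighbourhood base of pieces of one section, so continuity becomes a
  condition on characters only.\<close>

lemma continuous_map_from_arrows:
  assumes "\<And>a. a \<in> arrows G \<Longrightarrow> f a \<in> topspace Y"
    and "\<And>V s \<xi>. \<lbrakk>openin Y V; s \<in> carrier S; \<xi> \<in> act_dom s; f (germ S s \<xi>) \<in> V\<rbrakk>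
      \<Longrightarrow> \<exists>W. openin (character_topology S) W \<and> \<xi> \<in> W \<and> (\<forall>\<eta> \<in> W \<inter> act_dom s. f (germ S s \<eta>) \<in> V)"
  shows "continuous_map (arrow_top G) Y f"
  unfolding continuous_map_def
proof (intro conjI allI impI)
  show "f \<in> arrows G \<rightarrow> topspace Y" using assms(1) by auto
  fix V assume V: "openin Y V"
  show "openin (arrow_top G) {a \<in> arrows G. f a \<in> V}"
  proof (rule openin_arrowsI)
    fix s \<xi> assume s: "s \<in> carrier S" "\<xi> \<in> act_dom s" and "germ S s \<xi> \<in> {a \<in> arrows G. f a \<in> V}"
    then obtain W where "openin (character_topology S) W" "\<xi> \<in> W" "\<forall>\<eta> \<in> W \<inter> act_dom s. f (germ S s \<eta>) \<in> V"
      using assms(2)[OF V s] by auto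
    then show "\<exists>W. openin (character_topology S) W \<and> \<xi> \<in> W \<and> germ S s ` (W \<inter> act_dom s) \<subseteq> {a \<in> arrows G. f a \<in> V}"
      using s by (intro exI[of _ W]) (auto intro: germ_in_arrows)
  qed auto
qed

lemma continuous_src: "continuous_map (arrow_top G) (unit_top G) (src G)"
proof (rule continuous_map_from_arrows)
  fix V s \<xi> assume "openin (unit_top G) V" "s \<in> carrier S" "\<xi> \<in> act_dom s" "src G (germ S s \<xi>) \<in> V"
  then show "\<exists>W. openin (character_topology S) W \<and> \<xi> \<in> W \<and> (\<forall>\<eta> \<in> W \<inter> act_dom s. src G (germ S s \<eta>) \<in> V)"
    by (intro exI[of _ V]) (auto simp: src_germ unit_top_G)
qed (rule G.src_in)

lemma continuous_rng: "continuous_map (arrow_top G) (unit_top G) (rng G)"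
proof (rule continuous_map_from_arrows)
  fix V s \<xi> assume "openin (unit_top G) V" "s \<in> carrier S" "\<xi> \<in> act_dom s" "rng G (germ S s \<xi>) \<in> V"
  then show "\<exists>W. openin (character_topology S) W \<and> \<xi> \<in> W \<and> (\<forall>\<eta> \<in> W \<inter> act_dom s. rng G (germ S s \<eta>) \<in> V)"
    using openin_spectral_action_preimage[of s V]
    by (intro exI[of _ "{\<xi> \<in> act_dom s. \<beta> s \<xi> \<in> V}"]) (auto simp: rng_germ unit_top_G)
qed (rule G.rng_in)

lemma continuous_ident: "continuous_map (unit_top G) (arrow_top G) (ident G)"
  unfolding continuous_map_def
proof (intro conjI allI impI)
  show "ident G \<in> units G \<rightarrow> arrows G" using G.ident_in by auto
  fix A assume A: "openin (arrow_top G) A"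
  show "openin (unit_top G) {\<xi> \<in> units G. ident G \<xi> \<in> A}"
  proof (subst openin_subopen, intro ballI)
    fix \<xi> assume "\<xi> \<in> {\<xi> \<in> units G. ident G \<xi> \<in> A}"
    then have \<xi>: "\<xi> \<in> characters S" "ident G \<xi> \<in> A" by (auto simp: units_G)
    obtain e where e: "e \<in> idempotents S" "\<xi> e = 1" "\<xi> \<in> act_dom e" "ident G \<xi> = germ S e \<xi>"
      using \<xi>(1) by (rule ident_germ)
    obtain W where W: "openin (character_topology S) W" "\<xi> \<in> W" "W \<subseteq> act_dom e" "germ S e ` W \<subseteq> A"
      by (rule openin_arrowsD[OF A idem_closed[OF e(1)] e(3)]) (use \<xi>(2) e(4) in auto)
    \<comment> \<open>The set \<open>W\<close> lies where \<open>e\<close> has value 1, so the same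
      idempotent represents the unit at every point of \<open>W\<close>.\<close>
    have "ident G \<eta> = germ S e \<eta>" if "\<eta> \<in> W" for \<eta>
      using that W(3) e(1) by (intro ident_eq_germ) (auto simp: char_dom_def idem_star idem_idem)
    then have "W \<subseteq> {\<xi> \<in> units G. ident G \<xi> \<in> A}"
      using W by (auto simp: units_G char_dom_def)
    then show "\<exists>T. openin (unit_top G) T \<and> \<xi> \<in> T \<and> T \<subseteq> {\<xi> \<in> units G. ident G \<xi> \<in> A}"
      using W by (auto simp: unit_top_G)
  qed
qed

lemma continuous_ginv: "continuous_map (arrow_top G) (arrow_top G) (ginv G)"
proof (rule continuous_map_from_arrows)
  fix A s \<xi>
  assume A: "openin (arrow_top G) A" and s: "s \<in> carrier S" and \<xi>: "\<xi> \<in> act_dom s"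
    and "ginv G (germ S s \<xi>) \<in> A"
  then have "germ S (star S s) (\<beta> s \<xi>) \<in> A" by (simp add: ginv_germ)
  with A star_closed[OF s] spectral_action_dom_star[OF s \<xi>]
  obtain W where W: "openin (character_topology S) W" "\<beta> s \<xi> \<in> W" "W \<subseteq> act_dom (star S s)"
    "germ S (star S s) ` W \<subseteq> A"
    by (rule openin_arrowsD)
  show "\<exists>W. openin (character_topology S) W \<and> \<xi> \<in> W \<and> (\<forall>\<eta> \<in> W \<inter> act_dom s. ginv G (germ S s \<eta>) \<in> A)"
    using W s \<xi> openin_spectral_action_preimage[OF s W(1)]
    by (intro exI[of _ "{\<xi> \<in> act_dom s. \<beta> s \<xi> \<in> W}"]) (auto simp: ginv_germ)
qed (rule G.ginv_in)

lemma continuous_comp: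
  "continuous_map (subtopology (prod_topology (arrow_top G) (arrow_top G)) (composable G))
     (arrow_top G) (\<lambda>(a, b). comp G a b)"
  unfolding continuous_map_def
proof (intro conjI allI impI)
  let ?X = "subtopology (prod_topology (arrow_top G) (arrow_top G)) (composable G)"
  have X: "topspace ?X = composable G" by (auto simp: composable_def)
  show "(\<lambda>(a, b). comp G a b) \<in> topspace ?X \<rightarrow> arrows G"
    unfolding X by (auto simp: composable_def G.comp_in)
  fix A assume A: "openin (arrow_top G) A"
  show "openin ?X {x \<in> topspace ?X. (case x of (a, b) \<Rightarrow> comp G a b) \<in> A}"
    unfolding X
  proof (subst openin_subopen, intro ballI)
    fix x assume x: "x \<in> {x \<in> composable G. (case x of (a, b) \<Rightarrow> comp G a b) \<in> A}"
    then obtain a b where x_eq: "x = (a, b)" and "a \<in> arrows G" "b \<in> arrows G" "src G a = rng G b"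
      and ab: "comp G a b \<in> A"
      by (auto simp: composable_def)
    then obtain s t \<xi> where s: "s \<in> carrier S" and t: "t \<in> carrier S" and \<xi>: "\<xi> \<in> act_dom t"
      and \<beta>\<xi>: "\<beta> t \<xi> \<in> act_dom s" and a: "a = germ S s (\<beta> t \<xi>)" and b: "b = germ S t \<xi>"
      using arrow_pair_cases by metis
    have "germ S (s \<cdot> t) \<xi> \<in> A"
      using ab comp_germ[OF s t \<xi> \<beta>\<xi>] by (simp add: a b)
    with A mult_closed[OF s t] dom_mult[OF s t \<xi> \<beta>\<xi>]
    obtain W where W: "openin (character_topology S) W" "\<xi> \<in> W" "W \<subseteq> act_dom (s \<cdot> t)" "germ S (s \<cdot> t) ` W \<subseteq> A"
      by (rule openin_arrowsD)
    \<comment> \<open>Only the second factor has to be confined to \<open>W\<close>: composability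
      with the germ of \<open>t\<close> at \<open>\<eta>\<close> forces the first factor to be the
      germ of \<open>s\<close> at \<open>\<beta> t \<eta>\<close>.\<close>
    let ?U = "germ S s ` act_dom s" and ?V = "germ S t ` (W \<inter> act_dom t)"
    have U: "openin (arrow_top G) ?U" "openin (arrow_top G) ?V"
      using s t W by (auto intro!: openin_germs openin_dom)
    then have "openin ?X (composable G \<inter> ?U \<times> ?V)"
      by (subst Int_commute) (intro openin_subtopology_Int, simp add: openin_prod_Times_iff)
    moreover have "x \<in> composable G \<inter> ?U \<times> ?V"
      using x W \<xi> \<beta>\<xi> by (auto simp: x_eq a b)
    moreover have "comp G a' b' \<in> A" if ab': "(a', b') \<in> composable G" "a' \<in> ?U" "b' \<in> ?V" for a' b'
    proof -
      obtain \<zeta> \<eta> where \<zeta>: "\<zeta> \<in> act_dom s" "a' = germ S s \<zeta>" and \<eta>: "\<eta> \<in> W" "\<eta> \<in> act_dom t" "b' = germ S t \<eta>"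
        using ab' by auto
      then have "\<zeta> = \<beta> t \<eta>"
        using ab' s t by (simp add: composable_def src_germ rng_germ)
      then have "comp G a' b' = germ S (s \<cdot> t) \<eta>"
        using comp_germ[OF s t \<eta>(2)] \<zeta> \<eta> by simp
      then show ?thesis using \<eta> W by auto
    qed
    ultimately show "\<exists>T. openin ?X T \<and> x \<in> T \<and> T \<subseteq> {x \<in> composable G. (case x of (a, b) \<Rightarrow> comp G a b) \<in> A}"
      by (intro exI[of _ "composable G \<inter> ?U \<times> ?V"]) fastforce
  qed
qed

lemma src_image_germs: "s \<in> carrier S \<Longrightarrow> U \<subseteq> act_dom s \<Longrightarrow> src G ` germ S s ` U = U"
  by (auto simp: src_germ image_image subset_iff)

lemma open_map_src: "open_map (arrow_top G) (unit_top G) (src G)"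
  unfolding open_map_def
proof (intro allI impI)
  fix A assume A: "openin (arrow_top G) A"
  show "openin (unit_top G) (src G ` A)"
  proof (subst openin_subopen, intro ballI)
    fix \<xi> assume "\<xi> \<in> src G ` A"
    then obtain a where a: "a \<in> A" "\<xi> = src G a" by blast
    then have "a \<in> arrows G" using openin_subset[OF A] by blast
    then obtain s \<eta> where s: "s \<in> carrier S" "\<eta> \<in> act_dom s" "a = germ S s \<eta>" by (rule arrow_cases)
    then have "\<eta> = \<xi>" using a by (simp add: src_germ)
    obtain W where W: "openin (character_topology S) W" "\<eta> \<in> W" "W \<subseteq> act_dom s" "germ S s ` W \<subseteq> A"
      by (rule openin_arrowsD[OF A s(1,2)]) (use a s in auto)
    have "W \<subseteq> src G ` A"
      using src_image_germs[OF s(1) W(3)] W(4) by blast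
    then show "\<exists>T. openin (unit_top G) T \<and> \<xi> \<in> T \<and> T \<subseteq> src G ` A"
      using W \<open>\<eta> = \<xi>\<close> by (auto simp: unit_top_G)
  qed
qed

text \<open>The full section of \<open>s\<close> is an open neighbourhood on which
  \<open>src G\<close> inverts the map from characters to germs of \<open>s\<close>.\<close>

lemma local_homeomorphism_src: "local_homeomorphism (arrow_top G) (unit_top G) (src G)"
  unfolding local_homeomorphism_def
proof (intro ballI)
  fix a assume "a \<in> arrows G"
  then obtain s \<xi> where s: "s \<in> carrier S" "\<xi> \<in> act_dom s" "a = germ S s \<xi>" by (rule arrow_cases)
  let ?U = "germ S s ` act_dom s"
  have U: "openin (arrow_top G) ?U" using s by (intro openin_germs openin_dom) auto
  have srcU: "openin (unit_top G) (src G ` ?U)"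
    using open_map_src U by (simp add: open_map_def)
  have "homeomorphic_map (subtopology (arrow_top G) ?U) (subtopology (unit_top G) (src G ` ?U)) (src G)"
  proof (rule bijective_open_imp_homeomorphic_map)
    show "continuous_map (subtopology (arrow_top G) ?U) (subtopology (unit_top G) (src G ` ?U)) (src G)"
      by (intro continuous_map_into_subtopology continuous_map_from_subtopology continuous_src) auto
    show "open_map (subtopology (arrow_top G) ?U) (subtopology (unit_top G) (src G ` ?U)) (src G)"
      unfolding open_map_def
    proof (intro allI impI)
      fix V assume "openin (subtopology (arrow_top G) ?U) V"
      then have "openin (arrow_top G) V" "V \<subseteq> ?U"
        using U by (auto simp: openin_open_subtopology)
      then show "openin (subtopology (unit_top G) (src G ` ?U)) (src G ` V)"
        using open_map_src srcU by (auto simp: open_map_def openin_open_subtopology)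
    qed
    show "src G ` topspace (subtopology (arrow_top G) ?U) = topspace (subtopology (unit_top G) (src G ` ?U))"
      using openin_subset[OF U] openin_subset[OF srcU] by (simp add: Int_absorb1 inf_absorb2)
    show "inj_on (src G) (topspace (subtopology (arrow_top G) ?U))"
      using s(1) by (auto simp: inj_on_def src_germ)
  qed
  then show "\<exists>U. openin (arrow_top G) U \<and> a \<in> U \<and> openin (unit_top G) (src G ` U) \<and>
      homeomorphic_map (subtopology (arrow_top G) U) (subtopology (unit_top G) (src G ` U)) (src G)"
    using s U srcU by (intro exI[of _ ?U]) auto
qed

lemma etale_groupoid_G: "etale_groupoid G"
  by unfold_locales (fact continuous_src continuous_rng continuous_ident continuous_comp
      continuous_ginv local_homeomorphism_src)+

end

section \<open>Quotients of etale groupoids\<close>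

lemma homeomorphic_map_inverse:
  assumes "homeomorphic_map X Y f"
  obtains g where "homeomorphic_map Y X g"
    "\<And>x. x \<in> topspace X \<Longrightarrow> g (f x) = x" "\<And>y. y \<in> topspace Y \<Longrightarrow> f (g y) = y"
proof -
  obtain g where "homeomorphic_maps X Y f g"
    using assms by (auto simp: homeomorphic_map_maps)
  then show ?thesis
    using that[of g] by (simp add: homeomorphic_maps_map)
qed

text \<open>Here \<open>L\<close> is a bare record: two homeomorphisms that respect the operations
  move every axiom from \<open>K\<close> to \<open>L\<close>. With the quotient groupoid as
  \<open>L\<close>, this yields its etaleness. Composability is reflected because
  \<open>\<psi>\<close> is injective.\<close>

lemma etale_groupoid_transport:
  assumes K: "etale_groupoid K"
    and \<phi>: "homeomorphic_map (arrow_top K) (arrow_top L) \<phi>"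
    and \<psi>: "homeomorphic_map (unit_top K) (unit_top L) \<psi>"
    and src: "\<And>a. a \<in> arrows K \<Longrightarrow> src L (\<phi> a) = \<psi> (src K a)"
    and rng: "\<And>a. a \<in> arrows K \<Longrightarrow> rng L (\<phi> a) = \<psi> (rng K a)"
    and ginv: "\<And>a. a \<in> arrows K \<Longrightarrow> ginv L (\<phi> a) = \<phi> (ginv K a)"
    and ident: "\<And>x. x \<in> units K \<Longrightarrow> ident L (\<psi> x) = \<phi> (ident K x)"
    and comp: "\<And>a b. (a, b) \<in> composable K \<Longrightarrow> comp L (\<phi> a) (\<phi> b) = \<phi> (comp K a b)"
  shows "etale_groupoid_iso K L \<phi> \<psi>"
proof -
  interpret K: etale_groupoid K by (rule K)
  obtain \<phi>' where \<phi>': "homeomorphic_map (arrow_top L) (arrow_top K) \<phi>'"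
    "\<And>a. a \<in> arrows K \<Longrightarrow> \<phi>' (\<phi> a) = a" "\<And>b. b \<in> arrows L \<Longrightarrow> \<phi> (\<phi>' b) = b"
    by (rule homeomorphic_map_inverse[OF \<phi>]) blast
  obtain \<psi>' where \<psi>': "homeomorphic_map (unit_top L) (unit_top K) \<psi>'"
    "\<And>a. a \<in> units K \<Longrightarrow> \<psi>' (\<psi> a) = a" "\<And>b. b \<in> units L \<Longrightarrow> \<psi> (\<psi>' b) = b"
    by (rule homeomorphic_map_inverse[OF \<psi>]) blast
  have \<phi>_in: "\<phi> a \<in> arrows L" if "a \<in> arrows K" for a
    using that homeomorphic_imp_surjective_map[OF \<phi>] by blast
  have \<psi>_in: "\<psi> x \<in> units L" if "x \<in> units K" for x
    using that homeomorphic_imp_surjective_map[OF \<psi>] by blast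
  have \<phi>'_in: "\<phi>' b \<in> arrows K" if "b \<in> arrows L" for b
    using that homeomorphic_imp_surjective_map[OF \<phi>'(1)] by blast
  have arrow: "\<exists>a \<in> arrows K. b = \<phi> a" if "b \<in> arrows L" for b
    using that \<phi>'(3) \<phi>'_in by metis
  have unit: "\<exists>a \<in> units K. b = \<psi> a" if "b \<in> units L" for b
    using that homeomorphic_imp_surjective_map[OF \<psi>] by blast
  have \<psi>_eq: "\<psi> x = \<psi> y \<longleftrightarrow> x = y" if "x \<in> units K" "y \<in> units K" for x y
    using that \<psi>'(2) by metis
  have composable: "(\<phi> a, \<phi> b) \<in> composable L \<longleftrightarrow> (a, b) \<in> composable K"
    if "a \<in> arrows K" "b \<in> arrows K" for a b
    using that by (simp add: composable_def src rng \<psi>_eq K.src_in K.rng_in \<phi>_in)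
  have comp': "comp L (\<phi> a) (\<phi> b) = \<phi> (comp K a b)"
    if "a \<in> arrows K" "b \<in> arrows K" "src K a = rng K b" for a b
    using that by (intro comp) (simp add: composable_def)
  have src_rng: "\<psi> (src K a) = \<psi> (rng K b) \<longleftrightarrow> src K a = rng K b"
    if "a \<in> arrows K" "b \<in> arrows K" for a b
    using that by (simp add: \<psi>_eq K.src_in K.rng_in)
  note ops = src rng ginv ident comp' src_rng \<phi>_in \<psi>_in
    K.src_in K.rng_in K.ident_in K.src_ident K.rng_ident K.comp_in K.src_comp K.rng_comp
    K.comp_assoc K.comp_ident_right K.comp_ident_left K.ginv_in K.src_ginv K.rng_ginv
    K.comp_ginv_left K.comp_ginv_right
  have "algebraic_groupoid L"
    by unfold_locales (auto simp: ops dest!: arrow unit)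
  moreover have "topological_groupoid_axioms L"
  proof
    have c: "continuous_map (arrow_top L) (arrow_top K) \<phi>'" "continuous_map (arrow_top K) (arrow_top L) \<phi>"
      "continuous_map (unit_top L) (unit_top K) \<psi>'" "continuous_map (unit_top K) (unit_top L) \<psi>"
      using \<phi> \<phi>'(1) \<psi> \<psi>'(1) by (auto dest: homeomorphic_imp_continuous_map)
    note comps = continuous_map_compose[OF continuous_map_compose]
    show "continuous_map (arrow_top L) (unit_top L) (src L)"
      by (rule continuous_map_eq[OF comps[OF c(1) K.continuous_src c(4)]]) (auto simp: ops \<phi>'(2) dest!: arrow)
    show "continuous_map (arrow_top L) (unit_top L) (rng L)"
      by (rule continuous_map_eq[OF comps[OF c(1) K.continuous_rng c(4)]]) (auto simp: ops \<phi>'(2) dest!: arrow)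
    show "continuous_map (unit_top L) (arrow_top L) (ident L)"
      by (rule continuous_map_eq[OF comps[OF c(3) K.continuous_ident c(2)]]) (auto simp: ops \<psi>'(2) dest!: unit)
    show "continuous_map (arrow_top L) (arrow_top L) (ginv L)"
      by (rule continuous_map_eq[OF comps[OF c(1) K.continuous_ginv c(2)]]) (auto simp: ops \<phi>'(2) dest!: arrow)
    let ?X = "\<lambda>G. subtopology (prod_topology (arrow_top G) (arrow_top G)) (composable G)"
    have pair: "continuous_map (?X L) (?X K) (\<lambda>x. (\<phi>' (fst x), \<phi>' (snd x)))"
    proof (rule continuous_map_into_subtopology)
      show "continuous_map (?X L) (prod_topology (arrow_top K) (arrow_top K)) (\<lambda>x. (\<phi>' (fst x), \<phi>' (snd x)))"
        by (intro continuous_map_from_subtopology continuous_map_pairedI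
            continuous_map_compose[OF continuous_map_fst c(1), unfolded o_def]
            continuous_map_compose[OF continuous_map_snd c(1), unfolded o_def])
      show "(\<lambda>x. (\<phi>' (fst x), \<phi>' (snd x))) \<in> topspace (?X L) \<rightarrow> composable K"
        using composable by (auto simp: \<phi>'(2) dest!: arrow)
    qed
    show "continuous_map (?X L) (arrow_top L) (\<lambda>(a, b). comp L a b)"
      by (rule continuous_map_eq[OF comps[OF pair K.continuous_comp c(2)]])
        (auto simp: \<phi>'(2) composable comp dest!: arrow)
  qed
  moreover have "etale_groupoid_axioms L"
    unfolding etale_groupoid_axioms_def local_homeomorphism_def
  proof (intro ballI)
    fix b assume b: "b \<in> arrows L"
    then obtain U where U: "openin (arrow_top K) U" "\<phi>' b \<in> U" "openin (unit_top K) (src K ` U)"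
      "homeomorphic_map (subtopology (arrow_top K) U) (subtopology (unit_top K) (src K ` U)) (src K)"
      using K.local_homeomorphism_src \<phi>'_in unfolding local_homeomorphism_def by meson
    have UK: "U \<subseteq> arrows K" using U(1) by (rule openin_subset)
    have srcU: "src L ` \<phi> ` U = \<psi> ` src K ` U"
      using UK by (force simp: src image_image)
    have V: "openin (arrow_top L) (\<phi> ` U)" "openin (unit_top L) (src L ` \<phi> ` U)"
      using U \<phi> \<psi> homeomorphic_imp_open_map unfolding open_map_def srcU by blast+
    have VL: "\<phi> ` U \<subseteq> arrows L" using V(1) by (rule openin_subset)
    have "\<phi>' ` \<phi> ` U = U"
      using UK \<phi>'(2) by (force simp: image_image)
    then have 1: "homeomorphic_map (subtopology (arrow_top L) (\<phi> ` U)) (subtopology (arrow_top K) U) \<phi>'"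
      using UK VL by (intro homeomorphic_map_subtopologies[OF \<phi>'(1)]) (simp add: inf_absorb2)
    have "\<psi> ` (units K \<inter> src K ` U) = units L \<inter> \<psi> ` src K ` U"
      using openin_subset[OF U(3)] openin_subset[OF V(2)] unfolding srcU by (simp add: inf_absorb2)
    then have 2: "homeomorphic_map (subtopology (unit_top K) (src K ` U)) (subtopology (unit_top L) (\<psi> ` src K ` U)) \<psi>"
      by (rule homeomorphic_map_subtopologies[OF \<psi>])
    \<comment> \<open>On the image of \<open>U\<close>, the source map of \<open>L\<close> is the
      composite of \<open>\<phi>'\<close>, the source map of \<open>K\<close> and
      \<open>\<psi>\<close>.\<close>
    have "homeomorphic_map (subtopology (arrow_top L) (\<phi> ` U)) (subtopology (unit_top L) (src L ` \<phi> ` U)) (src L)"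
      unfolding srcU
      by (rule homeomorphic_map_eq[OF homeomorphic_map_compose[OF homeomorphic_map_compose[OF 1 U(4)] 2]])
        (use UK in \<open>auto simp: src \<phi>'(2) subset_iff\<close>)
    moreover have "b \<in> \<phi> ` U"
      using U(2) \<phi>'(3)[OF b] by (metis imageI)
    ultimately show "\<exists>V. openin (arrow_top L) V \<and> b \<in> V \<and> openin (unit_top L) (src L ` V) \<and>
        homeomorphic_map (subtopology (arrow_top L) V) (subtopology (unit_top L) (src L ` V)) (src L)"
      using V by blast
  qed
  ultimately have "etale_groupoid L"
    by (intro etale_groupoid.intro topological_groupoid.intro)
  then show ?thesis
    unfolding etale_groupoid_iso_def using K \<phi> \<psi> src rng ginv ident comp by auto
qed

lemma topspace_quotient_topology: "topspace (quotient_topology X R) = topspace X // R"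
proof
  show "topspace (quotient_topology X R) \<subseteq> topspace X // R"
    using openin_topspace[of "quotient_topology X R"] unfolding openin_quotient_topology by blast
  have "{x \<in> topspace X. R `` {x} \<in> topspace X // R} = topspace X"
    by (auto intro: quotientI)
  then have "openin (quotient_topology X R) (topspace X // R)"
    by (simp add: openin_quotient_topology)
  then show "topspace X // R \<subseteq> topspace (quotient_topology X R)"
    by (rule openin_subset)
qed

text \<open>First isomorphism theorem: the classes modulo \<open>H\<close> are the fibres of
  \<open>\<pi>\<close>, and the quotient topology on the fibres is that of \<open>K\<close> because
  \<open>\<pi>\<close> is a quotient map.\<close>

lemma quotient_by_kernel_iso:
  assumes G: "algebraic_groupoid G" and K: "etale_groupoid K"
    and \<pi>: "quotient_map (arrow_top G) (arrow_top K) \<pi>"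
    and \<psi>: "homeomorphic_map (unit_top K) (unit_top G) \<psi>"
    and src: "\<And>a. a \<in> arrows G \<Longrightarrow> src G a = \<psi> (src K (\<pi> a))"
    and rng: "\<And>a. a \<in> arrows G \<Longrightarrow> rng G a = \<psi> (rng K (\<pi> a))"
    and ginv: "\<And>a. a \<in> arrows G \<Longrightarrow> \<pi> (ginv G a) = ginv K (\<pi> a)"
    and ident: "\<And>x. x \<in> units K \<Longrightarrow> \<pi> (ident G (\<psi> x)) = ident K x"
    and comp: "\<And>a b. (a, b) \<in> composable G \<Longrightarrow> \<pi> (comp G a b) = comp K (\<pi> a) (\<pi> b)"
    and H: "H = {a \<in> arrows G. \<pi> a \<in> ident K ` units K}"
  shows "etale_groupoid_iso K (quotient_groupoid G H) (\<lambda>k. {a \<in> arrows G. \<pi> a = k}) \<psi>"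
proof -
  interpret G: algebraic_groupoid G by (rule G)
  interpret K: etale_groupoid K by (rule K)
  let ?R = "quotient_rel G H" and ?Q = "quotient_groupoid G H"
  define \<Phi> where "\<Phi> k = {a \<in> arrows G. \<pi> a = k}" for k
  have \<pi>_in: "\<pi> a \<in> arrows K" if "a \<in> arrows G" for a
    using that quotient_imp_surjective_map[OF \<pi>] by blast
  have \<pi>_surj: "\<exists>a. a \<in> \<Phi> k" if "k \<in> arrows K" for k
  proof -
    have "k \<in> \<pi> ` arrows G"
      using that by (simp add: quotient_imp_surjective_map[OF \<pi>])
    then show ?thesis by (auto simp: \<Phi>_def)
  qed
  have \<psi>_inj: "x = y" if "\<psi> x = \<psi> y" "x \<in> units K" "y \<in> units K" for x y
    using that homeomorphic_imp_injective_map[OF \<psi>] by (auto dest: inj_onD)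
  have R: "(a, b) \<in> ?R \<longleftrightarrow> a \<in> arrows G \<and> b \<in> arrows G \<and> \<pi> a = \<pi> b" for a b
  proof
    assume ab: "(a, b) \<in> ?R"
    then have a: "a \<in> arrows G" and b: "b \<in> arrows G" and s: "src G a = src G b"
      and h: "comp G a (ginv G b) \<in> H" by (auto simp: quotient_rel_def)
    let ?a = "\<pi> a" and ?b = "\<pi> b"
    \<comment> \<open>Injectivity of \<open>\<psi>\<close> brings equality of sources down to
      \<open>K\<close>, so that \<open>\<pi> a\<close> can be composed with the inverse of
      \<open>\<pi> b\<close>. Their product is a unit, which comparison of sources places at the
      range of \<open>\<pi> b\<close>; multiplying by \<open>\<pi> b\<close> on the right then gives
      \<open>\<pi> a = \<pi> b\<close>.\<close>
    have s': "src K ?a = src K ?b"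
      using s a b by (intro \<psi>_inj K.src_in \<pi>_in) (simp_all add: src)
    note c = \<pi>_in[OF a] \<pi>_in[OF b] K.ginv_in[OF \<pi>_in[OF b]] K.src_ginv[OF \<pi>_in[OF b]] K.rng_ginv[OF \<pi>_in[OF b]]
    have "\<pi> (comp G a (ginv G b)) = comp K ?a (ginv K ?b)"
      using a b s by (simp add: comp composable_def G.ginv_in G.rng_ginv ginv)
    then obtain x where x: "x \<in> units K" "comp K ?a (ginv K ?b) = ident K x"
      using h by (auto simp: H)
    have "x = src K (comp K ?a (ginv K ?b))"
      using x by (simp add: K.src_ident)
    also have "\<dots> = rng K ?b"
      using c s' by (simp add: K.src_comp)
    finally have x': "x = rng K ?b" .
    have "comp K (ginv K ?b) ?b = ident K (src K ?a)"
      by (simp add: K.comp_ginv_left c s')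
    then have "?a = comp K ?a (comp K (ginv K ?b) ?b)"
      by (simp only: K.comp_ident_right c)
    also have "\<dots> = comp K (ident K (rng K ?b)) ?b"
      using K.comp_assoc[of ?a "ginv K ?b" ?b] c s' x(2) x' by simp
    also have "\<dots> = ?b"
      using c by (simp add: K.comp_ident_left)
    finally show "a \<in> arrows G \<and> b \<in> arrows G \<and> \<pi> a = \<pi> b" using a b by simp
  next
    assume *: "a \<in> arrows G \<and> b \<in> arrows G \<and> \<pi> a = \<pi> b"
    then have s: "src G a = src G b" by (simp add: src)
    have "\<pi> (comp G a (ginv G b)) = comp K (\<pi> b) (ginv K (\<pi> b))"
      using * s by (simp add: comp composable_def G.ginv_in G.rng_ginv ginv)
    also have "\<dots> = ident K (rng K (\<pi> b))"
      using * by (simp add: K.comp_ginv_right \<pi>_in)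
    finally show "(a, b) \<in> ?R"
      using * s by (auto simp: quotient_rel_def H G.comp_in G.ginv_in G.rng_ginv K.rng_in \<pi>_in)
  qed
  have R_class: "?R `` {a} = \<Phi> (\<pi> a)" if "a \<in> arrows G" for a
    using that by (auto simp: R \<Phi>_def)
  have \<Phi>_eq: "\<Phi> k = \<Phi> l \<longleftrightarrow> k = l" if "k \<in> arrows K" for k l
    using \<pi>_surj[OF that] by (auto simp: \<Phi>_def)
  have top_Q: "arrow_top ?Q = quotient_topology (arrow_top G) ?R"
    by (simp add: quotient_groupoid_def)
  have classes: "arrows G // ?R = \<Phi> ` arrows K"
  proof -
    have "arrows G // ?R = \<Phi> ` \<pi> ` arrows G"
      by (auto simp: quotient_def R_class)
    then show ?thesis by (simp add: quotient_imp_surjective_map[OF \<pi>])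
  qed
  have arrows_Q: "arrows ?Q = \<Phi> ` arrows K"
    by (simp add: top_Q topspace_quotient_topology classes)
  have open_Q: "openin (arrow_top ?Q) U \<longleftrightarrow>
      U \<subseteq> \<Phi> ` arrows K \<and> openin (arrow_top G) {a \<in> arrows G. \<Phi> (\<pi> a) \<in> U}" for U
  proof -
    have "{a \<in> arrows G. ?R `` {a} \<in> U} = {a \<in> arrows G. \<Phi> (\<pi> a) \<in> U}"
      using R_class by auto
    then show ?thesis by (simp add: top_Q openin_quotient_topology classes)
  qed
  have open_K: "openin (arrow_top K) V \<longleftrightarrow> openin (arrow_top G) {a \<in> arrows G. \<pi> a \<in> V}"
    if "V \<subseteq> arrows K" for V
    using \<pi> that by (simp add: quotient_map_def)
  have homeo: "homeomorphic_map (arrow_top K) (arrow_top ?Q) \<Phi>"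
  proof (rule bijective_open_imp_homeomorphic_map)
    show "continuous_map (arrow_top K) (arrow_top ?Q) \<Phi>"
      unfolding continuous_map_def
    proof (intro conjI allI impI)
      show "\<Phi> \<in> arrows K \<rightarrow> arrows ?Q" by (auto simp: arrows_Q)
      fix U assume "openin (arrow_top ?Q) U"
      moreover have "{a \<in> arrows G. \<pi> a \<in> {k \<in> arrows K. \<Phi> k \<in> U}} = {a \<in> arrows G. \<Phi> (\<pi> a) \<in> U}"
        using \<pi>_in by auto
      ultimately show "openin (arrow_top K) {k \<in> arrows K. \<Phi> k \<in> U}"
        by (subst open_K) (auto simp: open_Q)
    qed
    show "open_map (arrow_top K) (arrow_top ?Q) \<Phi>"
      unfolding open_map_def
    proof (intro allI impI)
      fix V assume V: "openin (arrow_top K) V"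
      then have VK: "V \<subseteq> arrows K" by (rule openin_subset)
      \<comment> \<open>Fibres over distinct arrows of \<open>K\<close> differ because they are
        nonempty, so the preimage of the image of \<open>V\<close> is no larger than that of
        \<open>V\<close>.\<close>
      have "\<Phi> (\<pi> a) \<in> \<Phi> ` V \<longleftrightarrow> \<pi> a \<in> V" if "a \<in> arrows G" for a
        by (auto simp: \<Phi>_eq[OF \<pi>_in[OF that]])
      then have "{a \<in> arrows G. \<Phi> (\<pi> a) \<in> \<Phi> ` V} = {a \<in> arrows G. \<pi> a \<in> V}" by auto
      then show "openin (arrow_top ?Q) (\<Phi> ` V)"
        using V VK open_K[OF VK] unfolding open_Q by auto
    qed
    show "\<Phi> ` arrows K = arrows ?Q" by (simp add: arrows_Q)
    show "inj_on \<Phi> (arrows K)" by (auto simp: inj_on_def \<Phi>_eq)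
  qed
  have "etale_groupoid_iso K ?Q \<Phi> \<psi>"
  proof (rule etale_groupoid_transport[OF K homeo])
    show "homeomorphic_map (unit_top K) (unit_top ?Q) \<psi>"
      using \<psi> by (simp add: quotient_groupoid_def)
  next
    fix k assume k: "k \<in> arrows K"
    then obtain a where a: "a \<in> \<Phi> k" using \<pi>_surj by blast
    have "src G ` \<Phi> k = {\<psi> (src K k)}" "rng G ` \<Phi> k = {\<psi> (rng K k)}"
      using a by (auto intro!: image_eq_singletonI simp: \<Phi>_def src rng)
    then show "src ?Q (\<Phi> k) = \<psi> (src K k)" "rng ?Q (\<Phi> k) = \<psi> (rng K k)"
      by (simp_all add: quotient_groupoid_def)
    have "(\<Union>a \<in> \<Phi> k. ?R `` {ginv G a}) = \<Phi> (ginv K k)"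
      using a by (rule UN_eqI) (auto simp: \<Phi>_def R_class G.ginv_in ginv)
    then show "ginv ?Q (\<Phi> k) = \<Phi> (ginv K k)"
      by (simp add: quotient_groupoid_def)
  next
    fix x assume x: "x \<in> units K"
    then have "\<psi> x \<in> units G"
      using homeomorphic_imp_surjective_map[OF \<psi>] by blast
    then show "ident ?Q (\<psi> x) = \<Phi> (ident K x)"
      using x by (simp add: quotient_groupoid_def R_class G.ident_in ident)
  next
    fix k l assume kl: "(k, l) \<in> composable K"
    then have "k \<in> arrows K" "l \<in> arrows K" by (auto simp: composable_def)
    then obtain a b where ab: "a \<in> \<Phi> k" "b \<in> \<Phi> l"
      using \<pi>_surj by meson
    have "?R `` {comp G a b} = \<Phi> (comp K k l)" if "a \<in> \<Phi> k" "b \<in> \<Phi> l" for a b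
    proof -
      \<comment> \<open>Sources and ranges in \<open>G\<close> are the images under
        \<open>\<psi>\<close> of those in \<open>K\<close>, so any lifts of composable arrows are
        composable.\<close>
      have "(a, b) \<in> composable G"
        using that kl by (auto simp: composable_def \<Phi>_def src rng)
      then show ?thesis
        using that by (auto simp: R_class G.comp_in comp composable_def \<Phi>_def)
    qed
    with ab have "(\<Union>a \<in> \<Phi> k. \<Union>b \<in> \<Phi> l. ?R `` {comp G a b}) = \<Phi> (comp K k l)"
      by (rule UN_UN_eqI)
    then show "comp ?Q (\<Phi> k) (\<Phi> l) = \<Phi> (comp K k l)"
      by (simp add: quotient_groupoid_def)
  qed
  then show ?thesis unfolding \<Phi>_def .
qed

lemma (in algebraic_groupoid) algebraic_groupoid_restrict:
  assumes F: "\<And>a. a \<in> arrows G \<Longrightarrow> src G a \<in> F \<Longrightarrow> rng G a \<in> F"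
  shows "algebraic_groupoid (restrict_groupoid G F)"
proof -
  have "arrows (restrict_groupoid G F) = {a \<in> arrows G. src G a \<in> F}"
    and "units (restrict_groupoid G F) = units G \<inter> F"
    by (auto simp: restrict_groupoid_def)
  moreover have "src (restrict_groupoid G F) = src G" "rng (restrict_groupoid G F) = rng G"
    "ident (restrict_groupoid G F) = ident G" "comp (restrict_groupoid G F) = comp G"
    "ginv (restrict_groupoid G F) = ginv G"
    by (simp_all add: restrict_groupoid_def)
  ultimately show ?thesis
    by unfold_locales
      (auto simp: F src_in rng_in ident_in src_ident rng_ident comp_in src_comp rng_comp comp_assoc
        comp_ident_right comp_ident_left ginv_in src_ginv rng_ginv comp_ginv_left comp_ginv_right)
qed

section \<open>The universal groupoid of a quotient\<close>

context semigroup_congruence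
begin

definition pull :: "('a set \<Rightarrow> nat) \<Rightarrow> 'a \<Rightarrow> nat" where
  "pull \<xi> = (\<lambda>e \<in> idempotents S. \<xi> (q e))"

text \<open>Inverse of \<open>pull\<close> on \<open>F\<close>, using a chosen idempotent lift of
  \<open>f\<close>. A character in \<open>F\<close> factors through \<open>q\<close>, so there the
  choice does not affect the value.\<close>

definition push :: "('a \<Rightarrow> nat) \<Rightarrow> 'a set \<Rightarrow> nat" where
  "push \<eta> = (\<lambda>f \<in> idempotents T. \<eta> (SOME e. e \<in> idempotents S \<and> q e = f))"

abbreviation F :: "('a \<Rightarrow> nat) set" where
  "F \<equiv> congruence_characters S \<nu>"

abbreviation G_F :: "(('a \<times> ('a \<Rightarrow> nat)) set, 'a \<Rightarrow> nat) groupoid" where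
  "G_F \<equiv> restrict_groupoid G F"

lemma F_eq: "F = pull ` characters T"
  by (auto simp: congruence_characters_def pull_def q_def T_def)

lemma pull_apply: "e \<in> idempotents S \<Longrightarrow> pull \<xi> e = \<xi> (q e)"
  by (simp add: pull_def)

lemma pull_characters:
  assumes \<xi>: "\<xi> \<in> characters T"
  shows "pull \<xi> \<in> characters S"
proof -
  have "pull \<xi> \<in> idempotents S \<rightarrow>\<^sub>E {0, 1}"
    using T.character_01[OF \<xi>] q_idem by (force simp: pull_def)
  moreover have "pull \<xi> (e \<cdot> f) = pull \<xi> e * pull \<xi> f" if "e \<in> idempotents S" "f \<in> idempotents S" for e f
    using that T.character_mult[OF \<xi>] by (simp add: pull_apply idem_mult q_idem idem_closed flip: q_mult)
  moreover obtain e where "e \<in> idempotents S" "\<xi> (q e) = 1"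
    using T.character_nonzero[OF \<xi>] by (auto simp: idempotents_T)
  then have "\<exists>e \<in> idempotents S. pull \<xi> e \<noteq> 0"
    by (intro bexI[of _ e]) (simp_all add: pull_apply)
  ultimately show ?thesis by (simp add: characters_def)
qed

lemma push_pull:
  assumes \<xi>: "\<xi> \<in> characters T"
  shows "push (pull \<xi>) = \<xi>"
proof
  fix f
  show "push (pull \<xi>) f = \<xi> f"
  proof (cases "f \<in> idempotents T")
    case True
    then have "\<exists>e. e \<in> idempotents S \<and> q e = f" by (auto simp: idempotents_T)
    from someI_ex[OF this] show ?thesis
      using True by (simp add: push_def pull_apply)
  next
    case False
    then show ?thesis
      using \<xi> by (auto simp: push_def characters_def PiE_def extensional_def)
  qed
qed

lemma pull_eq_iff: "\<xi> \<in> characters T \<Longrightarrow> \<eta> \<in> characters T \<Longrightarrow> pull \<xi> = pull \<eta> \<longleftrightarrow> \<xi> = \<eta>"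
  by (metis push_pull)

text \<open>Each coordinate of \<open>pull\<close> and of \<open>push\<close> is a single
  evaluation, at \<open>q e\<close> and at the chosen lift of \<open>f\<close> respectively, so both
  maps are continuous.\<close>

lemma homeomorphic_map_pull:
  "homeomorphic_map (character_topology T) (subtopology (character_topology S) F) pull"
proof -
  have "continuous_map (character_topology T) (character_topology S) pull"
  proof (rule continuous_map_into_characters)
    show "pull \<in> topspace (character_topology T) \<rightarrow> characters S"
      by (simp add: T.topspace_characters pull_characters)
    show "continuous_map (character_topology T) (discrete_topology {0, 1}) (\<lambda>\<xi>. pull \<xi> e)"
      if "e \<in> idempotents S" for e
      using T.continuous_map_eval[OF q_idem[OF that]] by (simp add: pull_apply that)
  qed
  then have 1: "continuous_map (character_topology T) (subtopology (character_topology S) F) pull"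
    by (rule continuous_map_into_subtopology) (auto simp: T.topspace_characters F_eq)
  have 2: "continuous_map (subtopology (character_topology S) F) (character_topology T) push"
  proof (rule T.continuous_map_into_characters)
    show "push \<in> topspace (subtopology (character_topology S) F) \<rightarrow> characters T"
      by (auto simp: F_eq push_pull)
    show "continuous_map (subtopology (character_topology S) F) (discrete_topology {0, 1}) (\<lambda>\<eta>. push \<eta> f)"
      if f: "f \<in> idempotents T" for f
    proof -
      let ?e = "SOME e. e \<in> idempotents S \<and> q e = f"
      have "\<exists>e. e \<in> idempotents S \<and> q e = f" using f by (auto simp: idempotents_T)
      from someI_ex[OF this] have "?e \<in> idempotents S" by simp
      then show ?thesis
        using f continuous_map_from_subtopology[OF continuous_map_eval] by (simp add: push_def)
    qed
  qed
  have "homeomorphic_maps (character_topology T) (subtopology (character_topology S) F) pull push"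
    using 1 2 by (auto simp: homeomorphic_maps_def T.topspace_characters push_pull F_eq)
  then show ?thesis by (auto simp: homeomorphic_map_maps)
qed

section \<open>The morphism on germs induced by the quotient map\<close>

lemma pull_act_dom:
  assumes s: "s \<in> carrier S" and \<xi>: "\<xi> \<in> characters T"
  shows "pull \<xi> \<in> act_dom s \<longleftrightarrow> \<xi> \<in> T.act_dom (q s)"
  using assms by (simp add: char_dom_def pull_characters pull_apply star_mult_idem star_q q_mult star_closed)

lemma act_dom_cases:
  assumes s: "s \<in> carrier S" and \<eta>: "\<eta> \<in> act_dom s" "\<eta> \<in> F"
  obtains \<xi> where "\<xi> \<in> T.act_dom (q s)" "\<eta> = pull \<xi>"
  using assms pull_act_dom by (auto simp: F_eq)

lemma pull_spectral_action:
  assumes s: "s \<in> carrier S" and \<xi>: "\<xi> \<in> T.act_dom (q s)"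
  shows "\<beta> s (pull \<xi>) = pull (T.\<beta> (q s) \<xi>)"
proof
  fix e
  show "\<beta> s (pull \<xi>) e = pull (T.\<beta> (q s) \<xi>) e"
  proof (cases "e \<in> idempotents S")
    case True
    then show ?thesis
      using s idem_closed[OF True]
      by (simp add: spectral_action_apply pull_apply T.spectral_action_apply q_idem idem_conj' star_q
          q_mult mult_closed star_closed)
  qed (simp add: spectral_action_def pull_def)
qed

lemma pull_agree:
  assumes "s \<in> carrier S" "t \<in> carrier S" "agree s t (pull \<xi>)"
  shows "T.agree (q s) (q t) \<xi>"
proof -
  obtain e where e: "e \<in> idempotents S" "pull \<xi> e = 1" "s \<cdot> e = t \<cdot> e"
    using assms(3) by (auto simp: agree_def)
  then have "q s \<cdot>\<^bsub>T\<^esub> q e = q t \<cdot>\<^bsub>T\<^esub> q e"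
    using assms(1,2) by (simp add: q_mult idem_closed)
  then show ?thesis
    using e unfolding T.agree_def by (intro bexI[of _ "q e"]) (auto simp: pull_apply q_idem)
qed

definition \<pi> :: "('a \<times> ('a \<Rightarrow> nat)) set \<Rightarrow> ('a set \<times> ('a set \<Rightarrow> nat)) set" where
  "\<pi> A = (\<Union>(s, \<eta>) \<in> A. germ T (q s) (push \<eta>))"

text \<open>An idempotent witnessing agreement in \<open>S\<close> maps to a witness in
  \<open>T\<close>, so the result does not depend on the representative, and \<open>push\<close>
  recovers \<open>\<xi>\<close>.\<close>

lemma \<pi>_germ:
  assumes s: "s \<in> carrier S" and \<xi>: "\<xi> \<in> T.act_dom (q s)"
  shows "\<pi> (germ S s (pull \<xi>)) = germ T (q s) \<xi>"
proof -
  note \<xi>' = T.char_dom_characters[OF \<xi>]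
  have p: "pull \<xi> \<in> act_dom s" using s \<xi> \<xi>' by (simp add: pull_act_dom)
  have *: "germ T (q t) (push \<eta>) = germ T (q s) \<xi>" if "(t, \<eta>) \<in> germ S s (pull \<xi>)" for t \<eta>
  proof -
    have t: "t \<in> carrier S" "\<eta> = pull \<xi>" "pull \<xi> \<in> act_dom t" "agree s t (pull \<xi>)"
      using germ_memD[OF that] by auto
    have "germ T (q s) \<xi> = germ T (q t) \<xi>"
      using s t \<xi> \<xi>' by (intro T.germ_cong q_closed pull_agree) (simp_all add: pull_act_dom)
    then show ?thesis by (simp add: t push_pull \<xi>')
  qed
  show ?thesis
    unfolding \<pi>_def using germ_self[OF s p] by (rule UN_eqI) (clarify, rule *)
qed

lemma arrows_G_F: "arrows G_F = {a \<in> arrows G. src G a \<in> F}"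
  by (auto simp: restrict_groupoid_def)

lemma G_F_simps:
  "src G_F = src G" "rng G_F = rng G" "ident G_F = ident G" "comp G_F = comp G" "ginv G_F = ginv G"
  "arrow_top G_F = subtopology (arrow_top G) {a \<in> arrows G. src G a \<in> F}"
  "unit_top G_F = subtopology (character_topology S) F"
  by (simp_all add: restrict_groupoid_def unit_top_G)

lemma germ_pull_arrow:
  assumes s: "s \<in> carrier S" and \<xi>: "\<xi> \<in> T.act_dom (q s)"
  shows "pull \<xi> \<in> act_dom s" "germ S s (pull \<xi>) \<in> arrows G_F"
    "src G (germ S s (pull \<xi>)) = pull \<xi>" "rng G (germ S s (pull \<xi>)) = pull (T.\<beta> (q s) \<xi>)"
proof -
  note \<xi>' = T.char_dom_characters[OF \<xi>]
  show p: "pull \<xi> \<in> act_dom s" using s \<xi> \<xi>' by (simp add: pull_act_dom)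
  then show "src G (germ S s (pull \<xi>)) = pull \<xi>" "rng G (germ S s (pull \<xi>)) = pull (T.\<beta> (q s) \<xi>)"
    using s \<xi> by (simp_all add: src_germ rng_germ pull_spectral_action)
  moreover have "pull \<xi> \<in> F" using \<xi>' by (simp add: F_eq)
  ultimately show "germ S s (pull \<xi>) \<in> arrows G_F"
    using s p by (simp add: arrows_G_F germ_in_arrows)
qed

lemma arrow_G_F_cases:
  assumes "a \<in> arrows G_F"
  obtains s \<xi> where "s \<in> carrier S" "\<xi> \<in> T.act_dom (q s)" "a = germ S s (pull \<xi>)"
proof -
  have "a \<in> arrows G" "src G a \<in> F" using assms by (auto simp: arrows_G_F)
  then obtain s \<eta> where s: "s \<in> carrier S" "\<eta> \<in> act_dom s" "a = germ S s \<eta>"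
    by (elim arrow_cases)
  then have "\<eta> \<in> F" using \<open>src G a \<in> F\<close> by (simp add: src_germ)
  then show ?thesis using act_dom_cases s that by metis
qed

lemma algebraic_groupoid_G_F: "algebraic_groupoid G_F"
proof (rule G.algebraic_groupoid_restrict)
  fix a assume "a \<in> arrows G" "src G a \<in> F"
  then have "a \<in> arrows G_F" by (simp add: arrows_G_F)
  then obtain s \<xi> where "s \<in> carrier S" "\<xi> \<in> T.act_dom (q s)" "a = germ S s (pull \<xi>)"
    by (rule arrow_G_F_cases)
  then show "rng G a \<in> F"
    using T.spectral_action_characters q_closed by (auto simp: germ_pull_arrow F_eq)
qed

text \<open>Over characters in \<open>F\<close>, the section of \<open>s\<close> corresponds to the
  section of \<open>q s\<close>. The homeomorphism \<open>pull\<close> translates neighbourhoods of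
  characters in both directions, so \<open>\<pi>\<close> is continuous and open; representatives and
  characters lift, so it is onto.\<close>

lemma quotient_map_\<pi>: "quotient_map (arrow_top G_F) (arrow_top T.G) \<pi>"
proof (rule continuous_open_imp_quotient_map)
  have \<pi>_in: "\<pi> a \<in> arrows T.G" if "a \<in> arrows G_F" for a
    using that by (rule arrow_G_F_cases) (simp add: \<pi>_germ T.germ_in_arrows q_closed)
  show "continuous_map (arrow_top G_F) (arrow_top T.G) \<pi>"
    unfolding continuous_map_def
  proof (intro conjI allI impI)
    show "\<pi> \<in> arrows G_F \<rightarrow> arrows T.G" using \<pi>_in by auto
    fix V assume V: "openin (arrow_top T.G) V"
    show "openin (arrow_top G_F) {a \<in> arrows G_F. \<pi> a \<in> V}"
    proof (subst openin_subopen, intro ballI)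
      fix a assume a: "a \<in> {a \<in> arrows G_F. \<pi> a \<in> V}"
      then obtain s \<xi> where s: "s \<in> carrier S" and \<xi>: "\<xi> \<in> T.act_dom (q s)" and a_eq: "a = germ S s (pull \<xi>)"
        using arrow_G_F_cases by blast
      have "germ T (q s) \<xi> \<in> V"
        using a s \<xi> by (simp add: a_eq \<pi>_germ)
      with V q_closed[OF s] \<xi> obtain W where W: "openin (character_topology T) W" "\<xi> \<in> W"
        "W \<subseteq> T.act_dom (q s)" "germ T (q s) ` W \<subseteq> V"
        by (rule T.openin_arrowsD)
      \<comment> \<open>The image of \<open>W\<close> is open only relative to \<open>F\<close>; it
        is the trace of an open set \<open>U\<close>, and the restriction to sources in
        \<open>F\<close> removes the remaining germs over \<open>U\<close>.\<close>
      have "openin (subtopology (character_topology S) F) (pull ` W)"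
        using homeomorphic_imp_open_map[OF homeomorphic_map_pull] W(1) by (simp add: open_map_def)
      then obtain U where U: "openin (character_topology S) U" "pull ` W = U \<inter> F"
        by (auto simp: openin_subtopology)
      let ?A = "germ S s ` (U \<inter> act_dom s) \<inter> {a \<in> arrows G. src G a \<in> F}"
      have "openin (arrow_top G_F) ?A"
        unfolding G_F_simps using s U by (intro openin_subtopology_Int openin_germs openin_Int openin_dom) auto
      moreover have "a \<in> ?A"
        using a W(2) U(2) germ_pull_arrow[OF s \<xi>] by (auto simp: a_eq arrows_G_F)
      moreover have "b \<in> arrows G_F \<and> \<pi> b \<in> V" if b: "b \<in> ?A" for b
      proof -
        obtain \<eta> where \<eta>: "\<eta> \<in> U" "\<eta> \<in> act_dom s" "b = germ S s \<eta>" "src G b \<in> F"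
          using b by auto
        then have "\<eta> \<in> pull ` W" using s U(2) by (simp add: src_germ)
        then obtain \<zeta> where "\<zeta> \<in> W" "\<eta> = pull \<zeta>" by blast
        then have "\<pi> b = germ T (q s) \<zeta>" using W(3) s \<eta> by (auto simp: \<pi>_germ)
        then show ?thesis
          using b W(4) \<open>\<zeta> \<in> W\<close> by (auto simp: arrows_G_F)
      qed
      ultimately show "\<exists>A. openin (arrow_top G_F) A \<and> a \<in> A \<and> A \<subseteq> {a \<in> arrows G_F. \<pi> a \<in> V}"
        by (intro exI[of _ ?A]) blast
    qed
  qed
  show "open_map (arrow_top G_F) (arrow_top T.G) \<pi>"
    unfolding open_map_def
  proof (intro allI impI)
    fix A assume "openin (arrow_top G_F) A"
    then obtain B where B: "openin (arrow_top G) B" "A = B \<inter> arrows G_F"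
      by (auto simp: G_F_simps openin_subtopology)
    show "openin (arrow_top T.G) (\<pi> ` A)"
    proof (subst openin_subopen, intro ballI)
      fix k assume "k \<in> \<pi> ` A"
      then obtain a where a: "a \<in> B" "a \<in> arrows G_F" "k = \<pi> a" using B(2) by auto
      obtain s \<xi> where s: "s \<in> carrier S" and \<xi>: "\<xi> \<in> T.act_dom (q s)" and a_eq: "a = germ S s (pull \<xi>)"
        using a(2) by (rule arrow_G_F_cases)
      obtain W where W: "openin (character_topology S) W" "pull \<xi> \<in> W" "W \<subseteq> act_dom s" "germ S s ` W \<subseteq> B"
        by (rule openin_arrowsD[OF B(1) s germ_pull_arrow(1)[OF s \<xi>]]) (use a a_eq in auto)
      let ?W = "{\<xi> \<in> topspace (character_topology T). pull \<xi> \<in> W}"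
      have "continuous_map (character_topology T) (character_topology S) pull"
        using homeomorphic_imp_continuous_map[OF homeomorphic_map_pull]
        by (simp add: continuous_map_in_subtopology)
      then have W': "openin (character_topology T) ?W"
        using W(1) by (rule openin_continuous_map_preimage)
      have dom: "?W \<subseteq> T.act_dom (q s)"
        using W(3) pull_act_dom[OF s] by (auto simp: T.topspace_characters)
      have "openin (arrow_top T.G) (germ T (q s) ` ?W)"
        using q_closed[OF s] dom W' by (rule T.openin_germs)
      moreover have "k \<in> germ T (q s) ` ?W"
        using W(2) T.char_dom_characters[OF \<xi>] s \<xi> by (auto simp: a a_eq \<pi>_germ T.topspace_characters)
      moreover have "germ T (q s) \<zeta> \<in> \<pi> ` A" if \<zeta>: "\<zeta> \<in> ?W" for \<zeta>
      proof (rule image_eqI)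
        have "\<zeta> \<in> T.act_dom (q s)" using dom \<zeta> by blast
        then show "germ T (q s) \<zeta> = \<pi> (germ S s (pull \<zeta>))" "germ S s (pull \<zeta>) \<in> A"
          using s W(4) \<zeta> germ_pull_arrow(2) by (auto simp: \<pi>_germ B(2))
      qed
      ultimately show "\<exists>V. openin (arrow_top T.G) V \<and> k \<in> V \<and> V \<subseteq> \<pi> ` A"
        by (intro exI[of _ "germ T (q s) ` ?W"]) blast
    qed
  qed
  show "\<pi> ` arrows G_F = arrows T.G"
  proof
    show "\<pi> ` arrows G_F \<subseteq> arrows T.G" using \<pi>_in by auto
    show "arrows T.G \<subseteq> \<pi> ` arrows G_F"
    proof
      fix k assume "k \<in> arrows T.G"
      then obtain x \<xi> where "x \<in> carrier T" "\<xi> \<in> T.act_dom x" "k = germ T x \<xi>" by (rule T.arrow_cases)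
      then obtain s where "s \<in> carrier S" "\<xi> \<in> T.act_dom (q s)" "k = germ T (q s) \<xi>"
        by (auto simp: carrier_T)
      then show "k \<in> \<pi> ` arrows G_F"
        using germ_pull_arrow(2) \<pi>_germ by (metis imageI)
    qed
  qed
qed

section \<open>The kernel semigroup and its subgroupoid\<close>

abbreviation N :: "'a sgrp" where "N \<equiv> kernel_sgrp S \<nu>"

lemma N_simps: "carrier N = {s \<in> carrier S. q s \<in> idempotents T}" "mult N = mult S"
  by (simp_all add: kernel_sgrp_def q_def T_def)

lemma idempotents_N: "idempotents N = idempotents S"
  by (auto simp: idempotents_def[of N] N_simps q_idem idem_closed idem_idem) (simp add: idempotents_def)

text \<open>The class of \<open>s\<close> is idempotent, hence its own star, and so it is also the
  class of \<open>s*\<close>.\<close>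

lemma star_N: "s \<in> carrier N \<Longrightarrow> star S s \<in> carrier N"
  using T.idem_star by (simp add: N_simps star_closed flip: star_q)

sublocale N: inverse_semigroup N
proof (rule inverse_semigroupI)
  fix x assume x: "x \<in> carrier N"
  then show "\<exists>y \<in> carrier N. x \<cdot>\<^bsub>N\<^esub> y \<cdot>\<^bsub>N\<^esub> x = x \<and> y \<cdot>\<^bsub>N\<^esub> x \<cdot>\<^bsub>N\<^esub> y = y"
    using star_N[OF x] by (intro bexI[of _ "star S x"]) (simp_all add: N_simps mult_star_mult star_mult_star)
  fix y assume y: "y \<in> carrier N"
  then show "x \<cdot>\<^bsub>N\<^esub> y \<in> carrier N"
    using x T.idem_mult[of "q x" "q y"] by (simp add: N_simps mult_closed q_mult)
  show "x \<cdot>\<^bsub>N\<^esub> y = y \<cdot>\<^bsub>N\<^esub> x" if "x \<cdot>\<^bsub>N\<^esub> x = x" "y \<cdot>\<^bsub>N\<^esub> y = y"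
    using x y that idem_commute[of x y] by (simp add: N_simps idempotents_def)
qed (simp add: N_simps mult_assoc)

lemma star_N_eq: "s \<in> carrier N \<Longrightarrow> star N s = star S s"
  using star_N[of s] by (intro N.star_eqI) (simp_all add: N_simps mult_star_mult star_mult_star)

lemma char_dom_N: "char_dom N = char_dom S"
  by (simp add: char_dom_def characters_def idempotents_N N_simps fun_eq_iff)

lemma act_dom_N: "s \<in> carrier N \<Longrightarrow> N.act_dom s = act_dom s"
  by (simp add: char_dom_N star_N_eq N_simps(2))

text \<open>\<open>N\<close> and \<open>S\<close> have the same idempotents, so a witness in
  \<open>N\<close> is one in \<open>S\<close>: all members of the smaller class generate the same
  class over \<open>S\<close>.\<close>

lemma germ_inclusion_germ:
  assumes s: "s \<in> carrier N" and \<xi>: "\<xi> \<in> act_dom s"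
  shows "germ_inclusion S (germ N s \<xi>) = germ S s \<xi>"
proof -
  have sS: "s \<in> carrier S" using s by (simp add: N_simps)
  have *: "germ S t \<eta> = germ S s \<xi>" if "(t, \<eta>) \<in> germ N s \<xi>" for t \<eta>
  proof -
    have t: "t \<in> carrier N" "\<eta> = \<xi>" "\<xi> \<in> N.act_dom t" "N.agree s t \<xi>"
      using N.germ_memD[OF that] by auto
    have "agree s t \<xi>"
      using t(4) by (simp add: agree_def N.agree_def idempotents_N N_simps(2))
    moreover have "\<xi> \<in> act_dom t"
      using t(3) unfolding act_dom_N[OF t(1)] .
    ultimately have "germ S s \<xi> = germ S t \<xi>"
      using t(1) sS \<xi> by (intro germ_cong) (simp_all add: N_simps)
    then show ?thesis by (simp add: t)
  qed
  have "(s, \<xi>) \<in> germ N s \<xi>"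
    using s \<xi> by (intro N.germ_self) (simp_all only: act_dom_N)
  then have "(\<Union>x \<in> germ N s \<xi>. germ S (fst x) (snd x)) = germ S s \<xi>"
    by (rule UN_eqI) (clarify, simp only: fst_conv snd_conv, rule *)
  then show ?thesis
    by (auto simp: germ_inclusion_def germ_def)
qed

text \<open>Membership asks for one representative in \<open>N\<close>; other representatives of the
  same germ may lie outside, so a given one may have to be replaced.\<close>

lemma kernel_subgroupoid_eq:
  "kernel_subgroupoid S \<nu> = {germ S s (pull \<xi>) | s \<xi>. s \<in> carrier N \<and> \<xi> \<in> T.act_dom (q s)}"
proof -
  have "arrows (restrict_groupoid N.G F) = {a \<in> arrows N.G. src N.G a \<in> F}"
    by (auto simp: restrict_groupoid_def)
  also have "\<dots> = {germ N s \<eta> | s \<eta>. s \<in> carrier N \<and> \<eta> \<in> N.act_dom s \<and> \<eta> \<in> F}"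
    using N.src_germ by (auto simp: N.arrows_G) blast
  finally have "kernel_subgroupoid S \<nu> = {germ_inclusion S (germ N s \<eta>) | s \<eta>. s \<in> carrier N \<and> \<eta> \<in> N.act_dom s \<and> \<eta> \<in> F}"
    by (auto simp: kernel_subgroupoid_def)
  also have "\<dots> = {germ S s \<eta> | s \<eta>. s \<in> carrier N \<and> \<eta> \<in> act_dom s \<and> \<eta> \<in> F}"
    using germ_inclusion_germ act_dom_N by (metis (no_types, lifting))
  also have "\<dots> = {germ S s (pull \<xi>) | s \<xi>. s \<in> carrier N \<and> \<xi> \<in> T.act_dom (q s)}"
  proof -
    have "\<eta> \<in> act_dom s \<and> \<eta> \<in> F \<longleftrightarrow> (\<exists>\<xi> \<in> T.act_dom (q s). \<eta> = pull \<xi>)" if "s \<in> carrier N" for s \<eta>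
      using that pull_act_dom[of s] T.char_dom_characters by (auto simp: F_eq N_simps)
    then show ?thesis by (intro Collect_cong) metis
  qed
  finally show ?thesis .
qed

lemma kernel_subgroupoid_eq_kernel:
  "kernel_subgroupoid S \<nu> = {a \<in> arrows G_F. \<pi> a \<in> ident T.G ` units T.G}"
proof (intro equalityI subsetI)
  fix a assume "a \<in> kernel_subgroupoid S \<nu>"
  then obtain s \<xi> where s: "s \<in> carrier S" "q s \<in> idempotents T" and \<xi>: "\<xi> \<in> T.act_dom (q s)"
    and a: "a = germ S s (pull \<xi>)"
    by (auto simp: kernel_subgroupoid_eq N_simps)
  \<comment> \<open>For idempotent \<open>q s\<close> the domain condition is just this equation, so
    the germ of \<open>q s\<close> at \<open>\<xi>\<close> is a unit.\<close>
  have "\<xi> (q s) = 1"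
    using \<xi> s(2) by (simp add: T.idem_star T.idem_idem char_dom_def)
  then have "\<pi> a = ident T.G \<xi>"
    using s \<xi> T.char_dom_characters[OF \<xi>] by (simp add: a \<pi>_germ T.ident_eq_germ)
  then show "a \<in> {a \<in> arrows G_F. \<pi> a \<in> ident T.G ` units T.G}"
    using germ_pull_arrow(2)[OF s(1) \<xi>] T.char_dom_characters[OF \<xi>] by (simp add: a T.units_G)
next
  fix a assume "a \<in> {a \<in> arrows G_F. \<pi> a \<in> ident T.G ` units T.G}"
  then obtain \<zeta> where a: "a \<in> arrows G_F" and \<zeta>: "\<zeta> \<in> characters T" "\<pi> a = ident T.G \<zeta>"
    by (auto simp: T.units_G)
  obtain s \<xi> where s: "s \<in> carrier S" and \<xi>: "\<xi> \<in> T.act_dom (q s)" and a_eq: "a = germ S s (pull \<xi>)"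
    using a by (rule arrow_G_F_cases)
  obtain f where f: "f \<in> idempotents T" "\<zeta> f = 1" "\<zeta> \<in> T.act_dom f" "ident T.G \<zeta> = germ T f \<zeta>"
    using \<zeta>(1) by (rule T.ident_germ)
  have "germ T (q s) \<xi> = germ T f \<zeta>"
    using \<zeta>(2) s \<xi> f(4) by (simp add: a_eq \<pi>_germ)
  then have "T.agree (q s) f \<xi>"
    using T.germ_eq_iff[OF q_closed[OF s] T.idem_closed[OF f(1)] \<xi> f(3)] by blast
  then obtain g where g: "g \<in> idempotents T" "\<xi> g = 1" "q s \<cdot>\<^bsub>T\<^esub> g = f \<cdot>\<^bsub>T\<^esub> g"
    by (auto simp: T.agree_def)
  then obtain e where e: "e \<in> idempotents S" "g = q e" by (auto simp: idempotents_T)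
  note ec = idem_closed[OF e(1)]
  \<comment> \<open>The class is \<open>q s\<close> times \<open>g\<close>, which equals
    \<open>f g\<close>, a product of idempotents; \<open>f\<close> represents the unit and
    \<open>g\<close> witnesses the equality of germs.\<close>
  have "q (s \<cdot> e) \<in> idempotents T"
    using g T.idem_mult[OF f(1) g(1)] s ec by (simp add: e(2) flip: q_mult)
  then have se: "s \<cdot> e \<in> carrier N"
    using s ec by (simp add: N_simps mult_closed)
  note \<xi>' = T.char_dom_characters[OF \<xi>]
  have pe: "pull \<xi> \<in> char_dom S e" "pull \<xi> e = 1"
    using g(2) e \<xi>' by (simp_all add: char_dom_def pull_characters pull_apply)
  have ps: "pull \<xi> \<in> act_dom s" using s \<xi> by (rule germ_pull_arrow)
  \<comment> \<open>The idempotent \<open>e\<close> fixes \<open>pull \<xi>\<close>, so the domain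
    condition for \<open>s e\<close> reduces to that for \<open>s\<close>.\<close>
  have pse: "pull \<xi> \<in> act_dom (s \<cdot> e)"
    using pe ps by (intro dom_mult s ec) (simp_all add: dom_idem e spectral_action_idem)
  have "agree s (s \<cdot> e) (pull \<xi>)"
    unfolding agree_def using e pe s ec by (intro bexI[of _ e]) (simp_all add: mult_assoc idem_idem)
  then have "a = germ S (s \<cdot> e) (pull \<xi>)"
    unfolding a_eq using s ec ps pse by (intro germ_cong mult_closed)
  moreover have "\<xi> \<in> T.act_dom (q (s \<cdot> e))"
    using pse \<xi>' pull_act_dom[OF mult_closed[OF s ec]] by simp
  ultimately show "a \<in> kernel_subgroupoid S \<nu>"
    using se by (auto simp: kernel_subgroupoid_eq)
qed

lemma universal_groupoid_quotient_iso:
  "etale_groupoid_iso T.G (quotient_groupoid G_F (kernel_subgroupoid S \<nu>))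
     (\<lambda>k. {a \<in> arrows G_F. \<pi> a = k}) pull"
proof (rule quotient_by_kernel_iso[OF algebraic_groupoid_G_F T.etale_groupoid_G quotient_map_\<pi> _ _ _ _ _ _
      kernel_subgroupoid_eq_kernel])
  show "homeomorphic_map (unit_top T.G) (unit_top G_F) pull"
    using homeomorphic_map_pull by (simp add: T.unit_top_G G_F_simps)
next
  fix a assume "a \<in> arrows G_F"
  then obtain s \<xi> where s: "s \<in> carrier S" and \<xi>: "\<xi> \<in> T.act_dom (q s)" and a: "a = germ S s (pull \<xi>)"
    by (rule arrow_G_F_cases)
  note arrow = germ_pull_arrow[OF s \<xi>] and qs = q_closed[OF s]
  show "src G_F a = pull (src T.G (\<pi> a))" "rng G_F a = pull (rng T.G (\<pi> a))"
    using s \<xi> qs arrow by (simp_all add: a G_F_simps \<pi>_germ T.src_germ T.rng_germ)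
  have \<beta>: "T.\<beta> (q s) \<xi> \<in> T.act_dom (q (star S s))"
    using T.spectral_action_dom_star[OF qs \<xi>] by (simp add: star_q s)
  have "ginv G a = germ S (star S s) (pull (T.\<beta> (q s) \<xi>))"
    using s \<xi> arrow(1) by (simp add: a ginv_germ pull_spectral_action)
  then have "\<pi> (ginv G a) = germ T (q (star S s)) (T.\<beta> (q s) \<xi>)"
    using \<pi>_germ[OF star_closed[OF s] \<beta>] by simp
  then show "\<pi> (ginv G_F a) = ginv T.G (\<pi> a)"
    using s \<xi> qs by (simp add: a G_F_simps \<pi>_germ T.ginv_germ star_q)
next
  fix \<xi> assume "\<xi> \<in> units T.G"
  then have \<xi>: "\<xi> \<in> characters T" by (simp add: T.units_G)
  obtain e where e: "e \<in> idempotents S" "pull \<xi> e = 1" "pull \<xi> \<in> act_dom e" "ident G (pull \<xi>) = germ S e (pull \<xi>)"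
    using pull_characters[OF \<xi>] by (rule ident_germ)
  have "\<xi> \<in> T.act_dom (q e)"
    using e(3) \<xi> pull_act_dom[OF idem_closed[OF e(1)]] by simp
  then show "\<pi> (ident G_F (pull \<xi>)) = ident T.G \<xi>"
    using e \<xi> by (simp add: G_F_simps \<pi>_germ idem_closed T.ident_eq_germ[of \<xi> "q e"] q_idem pull_apply)
next
  fix a b assume "(a, b) \<in> composable G_F"
  then have "a \<in> arrows G_F" "b \<in> arrows G_F" and ab: "src G a = rng G b"
    by (auto simp: composable_def G_F_simps)
  then obtain s \<eta> t \<xi> where s: "s \<in> carrier S" and \<eta>: "\<eta> \<in> T.act_dom (q s)" and a: "a = germ S s (pull \<eta>)"
    and t: "t \<in> carrier S" and \<xi>: "\<xi> \<in> T.act_dom (q t)" and b: "b = germ S t (pull \<xi>)"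
    using arrow_G_F_cases by metis
  note A = germ_pull_arrow[OF s \<eta>] and B = germ_pull_arrow[OF t \<xi>]
  note qs = q_closed[OF s] and qt = q_closed[OF t]
  \<comment> \<open>Composability in \<open>G\<close> equates two pulled-back characters, and
    \<open>pull\<close> is injective on the characters of \<open>T\<close>.\<close>
  have \<eta>_eq: "\<eta> = T.\<beta> (q t) \<xi>"
    using ab A B pull_eq_iff[OF T.char_dom_characters[OF \<eta>] T.spectral_action_characters[OF qt \<xi>]]
    by (simp add: a b)
  have dom: "\<xi> \<in> T.act_dom (q (s \<cdot> t))"
    using T.dom_mult[OF qs qt \<xi>] \<eta> by (simp add: \<eta>_eq q_mult s t)
  have "comp G (germ S s (\<beta> t (pull \<xi>))) b = germ S (s \<cdot> t) (pull \<xi>)"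
    unfolding b using A(1) by (intro comp_germ s t B(1)) (simp add: pull_spectral_action t \<xi> \<eta>_eq)
  then have "comp G a b = germ S (s \<cdot> t) (pull \<xi>)"
    by (simp add: a \<eta>_eq pull_spectral_action t \<xi>)
  then have "\<pi> (comp G a b) = germ T (q (s \<cdot> t)) \<xi>"
    using \<pi>_germ[OF mult_closed[OF s t] dom] by simp
  also have "\<dots> = comp T.G (germ T (q s) \<eta>) (germ T (q t) \<xi>)"
    using T.comp_germ[OF qs qt \<xi>] \<eta> by (simp add: \<eta>_eq q_mult s t)
  finally show "\<pi> (comp G_F a b) = comp T.G (\<pi> a) (\<pi> b)"
    using s t \<xi> \<eta> by (simp add: G_F_simps a b \<pi>_germ)
qed

end

theorem theorem4p1p3:
  fixes S :: "'a sgrp" and \<nu> :: "('a \<times> 'a) set"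
  assumes "inverse_semigroup S" and "sgrp_congruence S \<nu>"
  shows "universal_groupoid (quotient_sgrp S \<nu>) \<cong>\<^sub>e
    quotient_groupoid (restrict_groupoid (universal_groupoid S) (congruence_characters S \<nu>))
      (kernel_subgroupoid S \<nu>)"
proof -
  interpret semigroup_congruence S \<nu>
    by (intro semigroup_congruence.intro semigroup_congruence_axioms.intro assms)
  show ?thesis
    using universal_groupoid_quotient_iso unfolding isomorphic_etale_groupoids_def T_def by blast
qed

end
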